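(* Let $\lambda>0$, $\nu\in(0,1]$, and let $\mathfrak{p}^\nu_k(t)$, $k\ge1$, $t>0$, be the state probabilities of a fractional Yule process with rate $\lambda$ and one initial progenitor. Then for all $t>0$ and $k\ge1$, $$\mathfrak{p}^\nu_k(t)=\int_0^\infty\int_0^\infty \frac{e^{-\int_0^{t^\nu}\omega\lambda\xi e^{\lambda\xi s}ds}\left[\int_0^{t^\nu}\omega\lambda\xi e^{\lambda\xi s}ds\right]^{k-1}}{(k-1)!}\,e^{-\omega}\,W_{-\nu,1-\nu}(-\xi)\,d\omega\,d\xi .$$ That is, the fractional Yule process is represented, at each fixed time $t$ (state $k$ corresponding to $k-1$ events), by a mixed non-homogeneous Poisson process evaluated at time $t^\nu$ with random intensity function $\lambda(s)=\Omega\lambda\Xi e^{\lambda\Xi s}$, $s>0$, where $\Omega$ is exponentially distributed with mean $1$ and $\Xi$ is independent of $\Omega$ with probability density $W_{-\nu,1-\nu}(-\xi)$, $\xi>0$.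
   Context: Fractional Yule process with rate $\lambda$: its state probabilities $\mathfrak{p}^\nu_k(t)=\Pr\{\mathfrak{N}^\nu(t)=k\mid \mathfrak{N}^\nu(0)=1\}$ are the solution of $\frac{d^\nu}{dt^\nu}\mathfrak{p}^\nu_k(t)=-\lambda k\,\mathfrak{p}^\nu_k(t)+\lambda(k-1)\mathfrak{p}^\nu_{k-1}(t)$, $k\ge1$, with $\mathfrak{p}^\nu_1(0)=1$ and $\mathfrak{p}^\nu_k(0)=0$ for $k>1$, where $\frac{d^\nu}{dt^\nu}$ is the Caputo derivative, $\frac{1}{\Gamma(1-\nu)}\int_0^t\frac{f'(s)}{(t-s)^\nu}ds$ for $\nu\in(0,1)$ and $f'(t)$ for $\nu=1$. Explicitly, $\mathfrak{p}^\nu_k(t)=\sum_{l=1}^k\binom{k-1}{l-1}(-1)^{l-1}E_{\nu,1}(-\lambda l t^\nu)$ with $E_{\alpha,\beta}(\tau)=\sum_{r\ge0}\tau^r/\Gamma(\alpha r+\beta)$. The Wright density is $W_{-\nu,1-\nu}(-\xi)=\sum_{r=0}^\infty\frac{(-\xi)^r}{r!\,\Gamma(1-\nu(r+1))}$, $\xi>0$, with $1/\Gamma=0$ at the poles of $\Gamma$. For $\nu=1$, $W_{-\nu,1-\nu}(-\xi)\,d\xi$ is understood as the point mass at $\xi=1$. *)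

theory Defs
  imports "HOL-Probability.Probability"
begin

definition caputo_deriv :: "real \<Rightarrow> (real \<Rightarrow> real) \<Rightarrow> real \<Rightarrow> real" where
  "caputo_deriv \<nu> f t =
     (if \<nu> = 1 then deriv f t
      else 1 / Gamma (1 - \<nu>) * (LBINT s:{0<..<t}. deriv f s / (t - s) powr \<nu>))"

text \<open>The class of functions in which the fractional Cauchy problem is posed. The derivative is not
  required at \<open>0\<close>: for \<open>\<nu> < 1\<close> the solution \<open>p 1\<close> behaves like
  \<open>1 - c * t powr \<nu>\<close> there. For \<open>\<nu> < 1\<close> the last
  clause makes \<open>deriv f\<close> integrable on each \<open>(0,t)\<close>, so that \<open>f\<close> is absolutely continuous.\<close>

definition caputo_differentiable :: "real \<Rightarrow> (real \<Rightarrow> real) \<Rightarrow> bool" where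
  "caputo_differentiable \<nu> f \<longleftrightarrow>
     continuous_on {0..} f \<and>
     (\<forall>t>0. f differentiable (at t)) \<and>
     (\<nu> \<noteq> 1 \<longrightarrow> (\<forall>t>0. set_integrable lborel {0<..<t} (\<lambda>s. deriv f s / (t - s) powr \<nu>)))"

text \<open>\<open>p k t\<close> is the probability of state \<open>k\<close> at time \<open>t\<close>, starting from one progenitor. The value
  \<open>p 0\<close> is irrelevant, since it only occurs with the factor \<open>k - 1 = 0\<close>.\<close>

definition fractional_yule_probs :: "real \<Rightarrow> real \<Rightarrow> (nat \<Rightarrow> real \<Rightarrow> real) \<Rightarrow> bool" where
  "fractional_yule_probs \<nu> lam p \<longleftrightarrow>
     (\<forall>k\<ge>1. caputo_differentiable \<nu> (p k)) \<and>
     (\<forall>k\<ge>1. \<forall>t>0. caputo_deriv \<nu> (p k) t =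
        - lam * real k * p k t + lam * (real k - 1) * p (k - 1) t) \<and>
     p 1 0 = 1 \<and> (\<forall>k>1. p k 0 = 0)"

text \<open>The library function \<^const>\<open>rGamma\<close> is \<open>1 / Gamma\<close>, with value \<open>0\<close> at the poles of
  \<^const>\<open>Gamma\<close>.\<close>

definition wright :: "real \<Rightarrow> real \<Rightarrow> real \<Rightarrow> real" where
  "wright \<alpha> \<beta> z = (\<Sum>r. z ^ r * rGamma (\<alpha> * real r + \<beta>) / fact r)"

definition has_wright_law :: "'a measure \<Rightarrow> real \<Rightarrow> ('a \<Rightarrow> real) \<Rightarrow> bool" where
  "has_wright_law M \<nu> X \<longleftrightarrow>
     (if \<nu> = 1 then X \<in> borel_measurable M \<and> (AE x in M. X x = 1)
      else distributed M lborel X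
             (\<lambda>\<xi>. ennreal (if 0 < \<xi> then wright (- \<nu>) (1 - \<nu>) (- \<xi>) else 0)))"

text \<open>Conditionally on the random element \<open>Z\<close>, the process \<open>N\<close> is a non-homogeneous Poisson process
  with intensity function \<open>\<l> (Z x)\<close>: given \<open>Z\<close>, increments over consecutive intervals are
  independent and Poisson distributed with mean the integrated intensity. The conditioning is
  expressed by integrating over the events \<open>Z \<in> B\<close>.\<close>

definition mixed_poisson_process ::
  "'a measure \<Rightarrow> 'z measure \<Rightarrow> ('a \<Rightarrow> 'z) \<Rightarrow> ('z \<Rightarrow> real \<Rightarrow> real) \<Rightarrow> (real \<Rightarrow> 'a \<Rightarrow> nat) \<Rightarrow> bool" where
  "mixed_poisson_process M S Z \<l> N \<longleftrightarrow>
     Z \<in> measurable M S \<and>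
     (\<lambda>(z, s). \<l> z s) \<in> borel_measurable (S \<Otimes>\<^sub>M lborel) \<and>
     (\<forall>t\<ge>0. N t \<in> measurable M (count_space UNIV)) \<and>
     (AE x in M. N 0 x = 0 \<and> mono_on {0..} (\<lambda>t. N t x) \<and>
        (\<forall>t\<ge>0. continuous (at_right t) (\<lambda>s. N s x))) \<and>
     (\<forall>B\<in>sets S. \<forall>n. \<forall>\<tau> :: nat \<Rightarrow> real. \<forall>j :: nat \<Rightarrow> nat.
        0 \<le> \<tau> 0 \<and> (\<forall>i<n. \<tau> i < \<tau> (Suc i)) \<longrightarrow>
        measure M {x \<in> space M. Z x \<in> B \<and> (\<forall>i<n. N (\<tau> (Suc i)) x = N (\<tau> i) x + j i)} =
        (LINT x|M. indicator B (Z x) *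
           (\<Prod>i<n. let m = (LBINT s:{\<tau> i..\<tau> (Suc i)}. \<l> (Z x) s) in
              exp (- m) * m ^ j i / fact (j i))))"

end

theory Submission
  imports Defs "HOL-Complex_Analysis.Cauchy_Integral_Theorem" "HOL-Real_Asymp.Real_Asymp"
begin

text \<open>
  Given \<open>\<Xi> = \<xi>\<close>, put \<open>x = lam * \<xi> * t powr \<nu>\<close>. The integrated intensity up to time
  \<open>t powr \<nu>\<close> is \<open>\<Omega> * (exp x - 1)\<close>, and mixing the Poisson probabilities with this mean over the
  exponential variable \<open>\<Omega>\<close> gives the geometric probabilities \<open>exp (- x) * (1 - exp (- x)) ^ n\<close>
  of a classical Yule process (\<open>poisson_exponential_mixture\<close>). Expanding the power turns the
  remaining average over \<open>\<Xi>\<close> into a combination of values of the Laplace transform of the Wright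
  density. The statement therefore follows from two facts.

  The first is that this Laplace transform at \<open>z\<close> is the Mittag-Leffler function at \<open>- z\<close>
  (\<open>laplace_transform_wright\<close>). Integrating the Wright series termwise produces a divergent series,
  so both functions are written as integrals over one contour that starts at infinity, turns around
  the origin and returns. By Hankel's formula (\<open>hankel_rGamma\<close>) the coefficients
  \<open>rGamma s\<close> of both series are the integrals of \<open>exp u * u powr (- s)\<close>. The contour consists of
  two conjugate rays that leave a vertex \<open>b > 0\<close>, so that only the imaginary part of the
  integral over the upper ray matters. If the angle \<open>\<theta>\<close> of that ray satisfies
  \<open>pi / 2 < \<theta>\<close> and \<open>\<nu> * \<theta> < pi / 2\<close>, then \<open>exp u\<close> decays along it, while
  \<open>Re (u powr \<nu>)\<close> stays above a bound that grows with \<open>b\<close>. The Wright function becomes the integral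
  of \<open>exp u * u powr (\<nu> - 1) * exp (- \<xi> * u powr \<nu>)\<close>, its Laplace transform the integral of
  \<open>exp u * u powr (\<nu> - 1) / (z + u powr \<nu>)\<close>, and for large \<open>b\<close> the geometric series of the latter
  converges uniformly and yields the Mittag-Leffler series.

  The second fact is that the Cauchy problem determines the state probabilities
  (\<open>fractional_yule_explicit\<close>). Fractional integration turns the Caputo equation into a Volterra
  equation with a weakly singular kernel (\<open>frac_integral_caputo_deriv\<close>). Iterating it bounds the
  difference of two continuous solutions by the terms of a convergent Mittag-Leffler series, which
  gives uniqueness (\<open>frac_integral_unique\<close>), and binomial combinations of the functions
  \<open>mittag_leffler \<nu> (- (lam * l) * t powr \<nu>)\<close> solve the equation.

  For the process itself, \<open>\<Xi>\<close> has the positive part of the Wright function as its density.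
  Both the Wright function and, since \<open>\<Xi>\<close> has a law, its positive part have integral \<open>1\<close>, so they
  agree almost everywhere (\<open>wright_nonneg_AE\<close>).
\<close>

section \<open>Lebesgue integrals over intervals\<close>

abbreviation lborel_on :: "real set \<Rightarrow> real measure"
  where "lborel_on A \<equiv> restrict_space lborel A"

lemma set_lebesgue_integral_lborel_on:
  fixes f :: "real \<Rightarrow> 'a::{banach, second_countable_topology}"
  assumes "A \<in> sets borel"
  shows "(LBINT x:A. f x) = integral\<^sup>L (lborel_on A) f"
    and "set_integrable lborel A f \<longleftrightarrow> integrable (lborel_on A) f"
  using assms by (simp_all add: set_lebesgue_integral_def set_integrable_def
      integral_restrict_space integrable_restrict_space)

lemma AE_lborel_on:
  assumes "A \<in> sets borel" "\<And>x. x \<in> A \<Longrightarrow> P x"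
  shows "AE x in lborel_on A. P x"
  using assms by (auto simp: AE_restrict_space_iff)

lemma pair_sigma_finite_lborel_on:
  assumes "A \<in> sets borel" "B \<in> sets borel"
  shows "pair_sigma_finite (lborel_on A) (lborel_on B)"
  using assms sigma_finite_lborel
  by (intro pair_sigma_finite.intro sigma_finite_measure_restrict_space) auto

lemma integral_halfline_derivative:
  fixes F f :: "real \<Rightarrow> complex"
  assumes "\<And>x. 0 < x \<Longrightarrow> (F has_vector_derivative f x) (at x)"
    and "\<And>x. 0 < x \<Longrightarrow> isCont f x"
    and "integrable (lborel_on {0<..}) f"
    and "(F \<longlongrightarrow> A) (at_right 0)" and "(F \<longlongrightarrow> B) at_top"
  shows "integral\<^sup>L (lborel_on {0<..}) f = B - A"
proof -
  have 1: "einterval 0 \<infinity> = {0<..}"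
    by (auto simp: einterval_def zero_ereal_def)
  have "(LBINT x=0..\<infinity>. f x) = B - A"
  proof (rule interval_integral_FTC_integrable[where F=F])
    show "((F \<circ> real_of_ereal) \<longlongrightarrow> A) (at_right 0)"
      using assms(4) unfolding zero_ereal_def by (simp add: ereal_tendsto_simps)
    show "((F \<circ> real_of_ereal) \<longlongrightarrow> B) (at_left \<infinity>)"
      using assms(5) by (simp add: ereal_tendsto_simps)
    show "set_integrable lborel (einterval 0 \<infinity>) f"
      unfolding 1 using assms(3) by (simp add: set_lebesgue_integral_lborel_on)
  qed (use assms(1,2) in \<open>auto simp: zero_ereal_def\<close>)
  then show ?thesis
    by (simp add: interval_lebesgue_integral_def 1 set_lebesgue_integral_lborel_on)
qed

lemma sums_integral_dominated:
  fixes f :: "nat \<Rightarrow> 'a \<Rightarrow> 'b::{banach, second_countable_topology}"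
  assumes f: "\<And>n. integrable M (f n)" and g: "integrable M g"
    and s: "AE x in M. (\<lambda>n. f n x) sums F x"
    and b: "AE x in M. \<forall>n. norm (\<Sum>i<n. f i x) \<le> g x"
    and F[measurable]: "F \<in> borel_measurable M"
  shows "integrable M F" "(\<lambda>n. integral\<^sup>L M (f n)) sums integral\<^sup>L M F"
proof -
  have m: "(\<lambda>x. \<Sum>i<n. f i x) \<in> borel_measurable M" for n
    using f by (auto intro!: borel_measurable_sum)
  have b': "AE x in M. norm (\<Sum>i<n. f i x) \<le> g x" for n
    using b by eventually_elim auto
  have s': "AE x in M. (\<lambda>n. \<Sum>i<n. f i x) \<longlonglongrightarrow> F x"
    using s by (simp add: sums_def)
  show "integrable M F"
    by (rule integrable_dominated_convergence[OF F m g s' b'])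
  have "(\<lambda>n. integral\<^sup>L M (\<lambda>x. \<Sum>i<n. f i x)) \<longlonglongrightarrow> integral\<^sup>L M F"
    by (rule integral_dominated_convergence[OF F m g s' b'])
  then show "(\<lambda>n. integral\<^sup>L M (f n)) sums integral\<^sup>L M F"
    using f by (simp add: sums_def)
qed

lemma integral_interval_derivative:
  fixes F f :: "real \<Rightarrow> complex"
  assumes ab: "a < b"
    and "\<And>x. a < x \<Longrightarrow> x < b \<Longrightarrow> (F has_vector_derivative f x) (at x)"
    and "\<And>x. a < x \<Longrightarrow> x < b \<Longrightarrow> isCont f x"
    and "integrable (lborel_on {a<..<b}) f"
    and "(F \<longlongrightarrow> A) (at_right a)" and "(F \<longlongrightarrow> B) (at_left b)"
  shows "integral\<^sup>L (lborel_on {a<..<b}) f = B - A"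
proof -
  have 1: "einterval a b = {a<..<b}"
    by (auto simp: einterval_def)
  have "(LBINT x=a..b. f x) = B - A"
  proof (rule interval_integral_FTC_integrable[where F=F])
    show "set_integrable lborel (einterval a b) f"
      unfolding 1 using assms(4) by (simp add: set_lebesgue_integral_lborel_on)
  qed (use assms in \<open>auto simp: ereal_tendsto_simps\<close>)
  then show ?thesis
    using ab by (simp add: interval_lebesgue_integral_def 1 set_lebesgue_integral_lborel_on)
qed

lemma finite_measure_lborel_on: "finite_measure (lborel_on {a<..<b::real})"
  by (cases "a \<le> b"; intro finite_measureI) (auto simp: emeasure_restrict_space space_restrict_space)

lemma (in pair_sigma_finite) integrable_product_bound:
  fixes f :: "_ \<Rightarrow> _::{banach, second_countable_topology}"
  assumes f[measurable]: "f \<in> borel_measurable (M1 \<Otimes>\<^sub>M M2)"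
    and g: "integrable M1 g" "integrable M2 (h :: _ \<Rightarrow> real)"
    and le: "\<And>x y. x \<in> space M1 \<Longrightarrow> y \<in> space M2 \<Longrightarrow> norm (f (x, y)) \<le> g x * h y"
  shows "integrable (M1 \<Otimes>\<^sub>M M2) f"
proof -
  note [measurable] = borel_measurable_integrable[OF g(1)] borel_measurable_integrable[OF g(2)]
  have "integrable (M1 \<Otimes>\<^sub>M M2) (\<lambda>p. g (fst p) * h (snd p))"
  proof (rule Fubini_integrable)
    show "integrable M1 (\<lambda>x. \<integral>y. norm (g (fst (x, y)) * h (snd (x, y))) \<partial>M2)"
      using g by (simp add: abs_mult)
    show "AE x in M1. integrable M2 (\<lambda>y. g (fst (x, y)) * h (snd (x, y)))"
      using g by simp
  qed measurable
  then show ?thesis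
    by (rule Bochner_Integration.integrable_bound)
      (auto simp: space_pair_measure intro!: AE_I2 order_trans[OF le abs_ge_self])
qed

lemma space_lborel_on: "space (lborel_on A) = A"
  by (simp add: space_restrict_space)

lemma lborel_on_subset:
  fixes f :: "real \<Rightarrow> 'b::{banach, second_countable_topology}"
  assumes "A \<in> sets borel" "B \<in> sets borel" "B \<subseteq> A"
  shows "integral\<^sup>L (lborel_on A) (\<lambda>x. indicator B x *\<^sub>R f x) = integral\<^sup>L (lborel_on B) f"
    and "integrable (lborel_on A) (\<lambda>x. indicator B x *\<^sub>R f x) \<longleftrightarrow> integrable (lborel_on B) f"
proof -
  have "(\<lambda>x. (indicator A x * indicator B x :: real) *\<^sub>R f x) = (\<lambda>x. indicator B x *\<^sub>R f x)"
    using assms(3) by (auto simp: indicator_def fun_eq_iff)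
  then show "integral\<^sup>L (lborel_on A) (\<lambda>x. indicator B x *\<^sub>R f x) = integral\<^sup>L (lborel_on B) f"
    and "integrable (lborel_on A) (\<lambda>x. indicator B x *\<^sub>R f x) \<longleftrightarrow> integrable (lborel_on B) f"
    using assms(1,2) by (simp_all add: integral_restrict_space integrable_restrict_space)
qed

section \<open>Gamma integrals and exponential domination\<close>

lemma has_bochner_integral_Gamma:
  fixes x R :: real
  assumes x: "0 < x" and R: "0 < R"
  shows "has_bochner_integral (lborel_on {0<..}) (\<lambda>u. u powr (x - 1) * exp (- (R * u))) (Gamma x / R powr x)"
proof (rule has_bochner_integral_nn_integral)
  have "ennreal (Gamma x) = (\<integral>\<^sup>+t. ennreal (indicator {0..} t * t powr (x-1) / exp t) \<partial>lborel)"
    by (rule Gamma_conv_nn_integral_real[OF x])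
  also have "\<dots> = \<bar>R\<bar> * (\<integral>\<^sup>+t. ennreal (indicator {0..} (0 + R * t) * (0 + R * t) powr (x-1) / exp (0 + R * t)) \<partial>lborel)"
    using R by (intro nn_integral_real_affine) auto
  also have "(\<integral>\<^sup>+t. ennreal (indicator {0..} (0 + R * t) * (0 + R * t) powr (x-1) / exp (0 + R * t)) \<partial>lborel)
     = (\<integral>\<^sup>+t. ennreal (R powr (x-1)) * (ennreal (t powr (x-1) * exp (- (R * t))) * indicator {0<..} t) \<partial>lborel)"
    using R by (intro nn_integral_cong)
      (auto simp: indicator_def zero_le_mult_iff powr_mult exp_minus divide_simps ennreal_mult'[symmetric])
  also have "\<dots> = ennreal (R powr (x-1)) * (\<integral>\<^sup>+t. ennreal (t powr (x-1) * exp (- (R * t))) * indicator {0<..} t \<partial>lborel)"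
    by (intro nn_integral_cmult) auto
  also have "(\<integral>\<^sup>+t. ennreal (t powr (x-1) * exp (- (R * t))) * indicator {0<..} t \<partial>lborel)
     = (\<integral>\<^sup>+u. ennreal (u powr (x - 1) * exp (- (R * u))) \<partial>lborel_on {0<..})"
    by (subst nn_integral_restrict_space) auto
  also have "\<bar>R\<bar> * (ennreal (R powr (x-1)) * (\<integral>\<^sup>+u. ennreal (u powr (x - 1) * exp (- (R * u))) \<partial>lborel_on {0<..}))
      = ennreal (R powr x) * (\<integral>\<^sup>+u. ennreal (u powr (x - 1) * exp (- (R * u))) \<partial>lborel_on {0<..})"
    using R by (simp add: mult.assoc[symmetric] ennreal_mult'[symmetric] powr_mult_base)
  finally have *: "ennreal (Gamma x) = ennreal (R powr x) * (\<integral>\<^sup>+u. ennreal (u powr (x - 1) * exp (- (R * u))) \<partial>lborel_on {0<..})" .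
  have "ennreal (Gamma x / R powr x) = ennreal (1 / R powr x) * ennreal (Gamma x)"
    using R by (subst ennreal_mult'[symmetric]) (auto simp: divide_simps)
  also have "\<dots> = ennreal (1 / R powr x) * ennreal (R powr x) * (\<integral>\<^sup>+u. ennreal (u powr (x - 1) * exp (- (R * u))) \<partial>lborel_on {0<..})"
    unfolding * by (simp add: mult.assoc)
  also have "ennreal (1 / R powr x) * ennreal (R powr x) = 1"
    using R by (subst ennreal_mult'[symmetric]) auto
  finally show "(\<integral>\<^sup>+u. ennreal (u powr (x - 1) * exp (- (R * u))) \<partial>lborel_on {0<..}) = ennreal (Gamma x / R powr x)"
    by simp
qed (use x R in \<open>auto intro!: measurable_restrict_space1 less_imp_le[OF Gamma_real_pos]\<close>)

lemma integrable_lborel_on_Gamma: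
  assumes "0 < x" "0 < R"
  shows "integrable (lborel_on {0<..}) (\<lambda>u. u powr (x - 1) * exp (- (R * u)))"
  using has_bochner_integral_Gamma[OF assms] by (simp add: has_bochner_integral_iff)

lemma sum_power_div_fact_le_exp:
  fixes y :: real
  assumes "0 \<le> y"
  shows "(\<Sum>i<n. y ^ i / fact i) \<le> exp y"
proof -
  have "(\<lambda>i. y ^ i / fact i) sums exp y"
    using exp_converges[of y] by (simp add: field_simps)
  then show ?thesis
    using assms by (metis (no_types, lifting) sum_le_suminf sums_iff finite_lessThan divide_nonneg_nonneg fact_ge_zero zero_le_power)
qed

text \<open>The identity is extended from real to complex \<open>c\<close> by expanding \<open>exp (- c * u)\<close> around a real
  point \<open>R\<close>. Every \<open>c\<close> in the right half plane lies in a disc with centre \<open>R > 0\<close> and radius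
  \<open>R\<close>, inside which termwise integration produces the binomial series of \<open>(c / R) powr (- x)\<close>.\<close>

lemma has_bochner_integral_Gamma_complex:
  fixes x :: real and c :: complex
  assumes x: "0 < x" and c: "0 < Re c"
  shows "has_bochner_integral (lborel_on {0<..})
    (\<lambda>u. of_real (u powr (x - 1)) * exp (- (c * of_real u))) (of_real (Gamma x) * c powr (- of_real x))"
proof -
  \<comment> \<open>Any \<open>R > (norm c)\<^sup>2 / (2 * Re c)\<close> makes \<open>norm (c - R) < R\<close>.\<close>
  define R where "R = (norm c)\<^sup>2 / Re c"
  define w where "w = c / of_real R - 1"
  have cn: "c \<noteq> 0" using c by auto
  have R: "0 < R" using c cn by (auto simp: R_def)
  have c_eq: "c = of_real R * (1 + w)" using R by (simp add: w_def)
  have *: "(norm (c - of_real R))\<^sup>2 = (norm c)\<^sup>2 - 2 * R * Re c + R\<^sup>2"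
    unfolding cmod_power2 by (simp add: power2_eq_square algebra_simps)
  have "R * Re c = (norm c)\<^sup>2" using c by (simp add: R_def)
  then have "(norm c)\<^sup>2 - 2 * R * Re c + R\<^sup>2 = R\<^sup>2 - (norm c)\<^sup>2" by simp
  also have "\<dots> < R\<^sup>2" using cn by simp
  finally have "norm (c - of_real R) < R"
    unfolding *[symmetric] using R by (meson less_imp_le power2_less_imp_less)
  moreover have "w = (c - of_real R) / of_real R" using R by (simp add: w_def diff_divide_distrib)
  ultimately have w: "norm w < 1" using R by (simp add: norm_divide)
  define f where "f n u = of_real (u powr (x - 1)) * of_real (exp (- (R * u))) * ((- (of_real (R * u) * w)) ^ n / fact n)"
    for n :: nat and u :: real
  have f_int: "has_bochner_integral (lborel_on {0<..}) (f n)
      (of_real (Gamma x) * of_real (R powr (- x)) * (((- of_real x) gchoose n) * w ^ n))" for n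
  proof -
    have "0 < x + real n" using x by simp
    from has_bochner_integral_Gamma[OF this R]
    have "has_bochner_integral (lborel_on {0<..})
       (\<lambda>u. complex_of_real (u powr (x + real n - 1) * exp (- (R * u))))
       (of_real (Gamma (x + real n) / R powr (x + real n)))"
      by (rule has_bochner_integral_of_real)
    then have "has_bochner_integral (lborel_on {0<..})
       (\<lambda>u. complex_of_real (u powr (x + real n - 1) * exp (- (R * u))) * ((- (of_real R * w)) ^ n / fact n))
       (of_real (Gamma (x + real n) / R powr (x + real n)) * ((- (of_real R * w)) ^ n / fact n))"
      by (rule has_bochner_integral_mult_left)
    also have "?this \<longleftrightarrow> has_bochner_integral (lborel_on {0<..}) (f n)
       (of_real (Gamma (x + real n) / R powr (x + real n)) * ((- (of_real R * w)) ^ n / fact n))"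
    proof (rule has_bochner_integral_cong)
      fix u assume "u \<in> space (lborel_on {0<..})"
      then have u: "0 < u" by (simp add: space_restrict_space)
      then have "u powr (x + real n - 1) = u powr (x - 1) * u ^ n"
        using u by (simp add: powr_realpow[symmetric] powr_add[symmetric] algebra_simps)
      then show "complex_of_real (u powr (x + real n - 1) * exp (- (R * u))) * ((- (of_real R * w)) ^ n / fact n) = f n u"
        by (simp add: f_def power_mult_distrib power_minus[of "_ * _"])
    qed auto
    finally show ?thesis
    proof (rule back_subst[where P="has_bochner_integral (lborel_on {0<..}) (f n)"])
      have "Gamma (x + real n) = Gamma x * pochhammer x n"
      proof -
        have "x \<notin> \<int>\<^sub>\<le>\<^sub>0" using x by (auto elim!: nonpos_Ints_cases)
        then show ?thesis using pochhammer_Gamma[of x n] Gamma_real_pos[OF x] by simp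
      qed
      moreover have "((- of_real x) gchoose n) = ((-1) ^ n * of_real (pochhammer x n) / fact n :: complex)"
        by (simp add: gbinomial_pochhammer pochhammer_of_real)
      moreover have "R powr (x + real n) = R powr x * R ^ n" 
        using R by (simp add: powr_add powr_realpow)
      ultimately show "(of_real (Gamma (x + real n) / R powr (x + real n)) * ((- (of_real R * w)) ^ n / fact n))
        = (of_real (Gamma x) * of_real (R powr (- x)) * (((- of_real x) gchoose n) * w ^ n))"
        using R by (simp add: power_mult_distrib power_minus[of "_ * _"] power_minus[of w] powr_minus divide_simps)
    qed
  qed
  let ?F = "\<lambda>u. of_real (u powr (x - 1)) * exp (- (c * of_real u))"
  have *: "?F u = of_real (u powr (x - 1)) * of_real (exp (- (R * u))) * exp (- (of_real (R * u) * w))" for u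
    by (subst c_eq) (simp add: exp_of_real[symmetric] exp_add[symmetric] ring_distribs mult_ac)
  have s: "(\<lambda>n. f n u) sums ?F u" for u
    unfolding * f_def using exp_converges[of "- (of_real (R * u) * w)"]
    by (intro sums_mult) (simp add: scaleR_conv_of_real field_simps)
  define g where "g u = u powr (x - 1) * exp (- (R * (1 - norm w) * u))" for u
  have g: "integrable (lborel_on {0<..}) g"
    unfolding g_def using x R w by (intro integrable_lborel_on_Gamma) auto
  have b: "norm (\<Sum>i<n. f i u) \<le> g u" if "0 < u" for n u
  proof -
    have "norm (\<Sum>i<n. f i u) \<le> (\<Sum>i<n. norm (f i u))" by (rule norm_sum)
    also have "\<dots> = u powr (x - 1) * exp (- (R * u)) * (\<Sum>i<n. (R * u * norm w) ^ i / fact i)"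
      using R that by (simp add: f_def sum_distrib_left norm_mult norm_divide norm_power abs_mult)
    also have "\<dots> \<le> u powr (x - 1) * exp (- (R * u)) * exp (R * u * norm w)"
      using R that by (intro mult_left_mono sum_power_div_fact_le_exp) auto
    also have "\<dots> = g u"
      by (simp add: g_def exp_add[symmetric] algebra_simps)
    finally show ?thesis .
  qed
  have F: "?F \<in> borel_measurable (lborel_on {0<..})"
    by (intro measurable_restrict_space1) measurable
  have 1: "integrable (lborel_on {0<..}) ?F" "(\<lambda>n. integral\<^sup>L (lborel_on {0<..}) (f n)) sums integral\<^sup>L (lborel_on {0<..}) ?F"
    by (rule sums_integral_dominated[where f=f and g=g];
        use f_int g s b F in \<open>force simp: has_bochner_integral_iff intro!: AE_lborel_on\<close>)+
  have "integral\<^sup>L (lborel_on {0<..}) (f n) = of_real (Gamma x) * of_real (R powr (- x)) * (((- of_real x) gchoose n) * w ^ n)" for n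
    using f_int[of n] by (simp add: has_bochner_integral_iff)
  with 1 have "(\<lambda>n. of_real (Gamma x) * of_real (R powr (- x)) * (((- of_real x) gchoose n) * w ^ n)) sums integral\<^sup>L (lborel_on {0<..}) ?F"
    by simp
  moreover have "(\<lambda>n. of_real (Gamma x) * of_real (R powr (- x)) * (((- of_real x) gchoose n) * w ^ n)) sums
     (of_real (Gamma x) * of_real (R powr (- x)) * (1 + w) powr (- of_real x))"
    by (intro sums_mult gen_binomial_complex w)
  ultimately have "integral\<^sup>L (lborel_on {0<..}) ?F = of_real (Gamma x) * of_real (R powr (- x)) * (1 + w) powr (- of_real x)"
    by (rule sums_unique2)
  also have "\<dots> = of_real (Gamma x) * c powr (- of_real x)"
  proof -
    have w1: "1 + w \<noteq> 0" using cn c_eq by auto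
    then have "c powr (- of_real x) = exp (- of_real x * (of_real (ln R) + Ln (1 + w)))"
      using cn R by (subst powr_def, subst (2) c_eq, subst Ln_times_of_real) (auto simp: Ln_of_real)
    also have "\<dots> = of_real (R powr (- x)) * (1 + w) powr (- of_real x)"
      using R w1 by (simp add: powr_def ring_distribs exp_add exp_of_real[symmetric] exp_diff exp_minus divide_simps)
    finally show ?thesis by simp
  qed
  finally show ?thesis using 1(1) by (simp add: has_bochner_integral_iff)
qed

text \<open>The next two bounds show that along the contour below the exponential decay beats every power and
  also \<open>exp (K * y powr \<nu>)\<close>. The latter, where \<open>\<nu> < 1\<close> is essential, dominates the Wright series.\<close>

lemma powr_le_exp_linear:
  fixes m e :: real
  assumes "0 \<le> m" "0 < e"
  obtains C where "\<And>y. 0 < y \<Longrightarrow> y powr m \<le> exp (e * y + C)"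
proof (cases "m = 0")
  case False
  with assms have d: "0 < e / m" by simp
  show ?thesis
  proof (rule that)
    fix y :: real assume y: "0 < y"
    have "ln (e / m * y) \<le> e / m * y - 1" using d y by (intro ln_le_minus_one mult_pos_pos)
    also have "ln (e / m * y) = ln (e / m) + ln y"
      using d y by (intro ln_mult_pos)
    finally have "m * ln y \<le> m * (e / m * y - 1 - ln (e / m))"
      using y d assms by (intro mult_left_mono) auto
    also have "\<dots> = e * y + m * (- 1 - ln (e / m))" using False by (simp add: field_simps)
    finally show "y powr m \<le> exp (e * y + m * (- 1 - ln (e / m)))"
      using y by (simp add: powr_def)
  qed
qed (use assms that[of 0] in auto)

lemma mult_powr_le_linear:
  fixes \<nu> e K :: real
  assumes "0 < \<nu>" "\<nu> < 1" "0 < e" "0 \<le> K"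
  obtains C where "\<And>y. 0 < y \<Longrightarrow> K * y powr \<nu> \<le> e * y + C"
proof -
  define Y where "Y = (e / (K + 1)) powr (- 1 / (1 - \<nu>))"
  have Y: "0 < Y" using assms by (simp add: Y_def)
  have YY: "Y powr (\<nu> - 1) = e / (K + 1)"
  proof -
    have "- 1 / (1 - \<nu>) * (\<nu> - 1) = 1" using assms by (simp add: divide_simps)
    then show ?thesis using assms by (simp add: Y_def powr_powr)
  qed
  have "K * y powr \<nu> \<le> e * y + K * Y powr \<nu>" if y: "0 < y" for y
  proof (cases "y \<le> Y")
    case True
    then have "K * y powr \<nu> \<le> K * Y powr \<nu>" using assms y by (intro mult_left_mono powr_mono2) auto
    then show ?thesis using assms y by (simp add: add_increasing)
  next
    case False
    have "y powr (\<nu> - 1) \<le> Y powr (\<nu> - 1)"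
      using False Y assms by (intro powr_mono2') auto
    then have "K * y powr (\<nu> - 1) * y \<le> K * (e / (K + 1)) * y"
      unfolding YY using assms y by (intro mult_right_mono mult_left_mono) auto
    also have "\<dots> \<le> e * y" using assms y by (intro mult_right_mono) (auto simp: field_simps)
    also have "K * y powr (\<nu> - 1) * y = K * y powr \<nu>" using y by (simp add: powr_diff)
    finally show ?thesis using assms by (simp add: add_increasing2)
  qed
  then show ?thesis by (rule that)
qed

lemma integrable_exp_decay:
  fixes b c K m \<nu> :: real
  assumes "0 < b" "0 < c" "0 \<le> m" "0 \<le> K" "0 < \<nu>" "\<nu> < 1"
  shows "integrable (lborel_on {0<..}) (\<lambda>t. exp (- (c * t)) * (b + t) powr m * exp (K * (b + t) powr \<nu>))"
proof -
  obtain A where A: "\<And>y. 0 < y \<Longrightarrow> y powr m \<le> exp (c / 4 * y + A)"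
    using powr_le_exp_linear[of m "c / 4"] assms by auto
  obtain B where B: "\<And>y. 0 < y \<Longrightarrow> K * y powr \<nu> \<le> c / 4 * y + B"
    using mult_powr_le_linear[of \<nu> "c / 4" K] assms by auto
  have i: "integrable (lborel_on {0<..}) (\<lambda>t. exp (c / 2 * b + A + B) * (t powr (1 - 1) * exp (- (c / 2 * t))))"
    using assms by (intro integrable_mult_right integrable_lborel_on_Gamma) auto
  show ?thesis
  proof (rule Bochner_Integration.integrable_bound[OF i])
    show "(\<lambda>t. exp (- (c * t)) * (b + t) powr m * exp (K * (b + t) powr \<nu>)) \<in> borel_measurable (lborel_on {0<..})"
      by (intro measurable_restrict_space1) measurable
    have "norm (exp (- (c * t)) * (b + t) powr m * exp (K * (b + t) powr \<nu>))
       \<le> norm (exp (c / 2 * b + A + B) * (t powr (1 - 1) * exp (- (c / 2 * t))))" if t: "0 < t" for t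
    proof -
      have y: "0 < b + t" using assms t by simp
      have "exp (- (c * t)) * (b + t) powr m * exp (K * (b + t) powr \<nu>)
         \<le> exp (- (c * t)) * exp (c / 4 * (b + t) + A) * exp (c / 4 * (b + t) + B)"
        using A[OF y] B[OF y] by (intro mult_mono) auto
      also have "\<dots> = exp (c / 2 * b + A + B) * exp (- (c / 2 * t))"
        by (simp add: exp_add[symmetric] field_simps)
      finally show ?thesis using t by simp
    qed
    then show "AE t in lborel_on {0<..}. norm (exp (- (c * t)) * (b + t) powr m * exp (K * (b + t) powr \<nu>))
       \<le> norm (exp (c / 2 * b + A + B) * (t powr (1 - 1) * exp (- (c / 2 * t))))"
      by (intro AE_lborel_on) auto
  qed
qed

section \<open>Hankel's integral for the reciprocal Gamma function\<close>

lemma lborel_on_ident[measurable]: "(\<lambda>x. x) \<in> borel_measurable (lborel_on A)"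
  by (intro measurable_restrict_space1) measurable

lemma lborel_on_pair[measurable]:
  "fst \<in> borel_measurable (lborel_on A \<Otimes>\<^sub>M lborel_on B)"
  "snd \<in> borel_measurable (lborel_on A \<Otimes>\<^sub>M lborel_on B)"
  using measurable_compose[OF measurable_fst lborel_on_ident] measurable_compose[OF measurable_snd lborel_on_ident]
  by (simp_all add: comp_def)

lemma norm_powr_of_real:
  fixes z :: complex
  assumes "z \<noteq> 0"
  shows "norm (z powr of_real x) = norm z powr x"
  using assms by (simp add: powr_def)

text \<open>The integrand of Hankel's contour integral for \<open>rGamma s\<close>.\<close>

definition hankel_fun :: "real \<Rightarrow> complex \<Rightarrow> complex"
  where "hankel_fun s u = exp u * u powr (- of_real s)"

lemma hankel_fun_derivative:
  assumes "u \<notin> \<real>\<^sub>\<le>\<^sub>0"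
  shows "(hankel_fun s has_field_derivative hankel_fun s u - of_real s * hankel_fun (s + 1) u) (at u)"
proof -
  have "u \<noteq> 0" using assms by auto
  then show ?thesis
    unfolding hankel_fun_def [abs_def] using assms
    by (auto intro!: derivative_eq_intros simp: algebra_simps minus_diff_commute[of 1])
qed

lemma hankel_fun_measurable[measurable]: "hankel_fun s \<in> borel_measurable borel"
  unfolding hankel_fun_def[abs_def] by measurable

lemma hankel_fun_of_real:
  assumes "0 \<le> x"
  shows "hankel_fun s (of_real x) = of_real (exp x * x powr (- s))"
  using assms powr_of_real[of x "- s"] by (simp add: hankel_fun_def exp_of_real)

lemma norm_hankel_fun: "u \<noteq> 0 \<Longrightarrow> norm (hankel_fun s u) = exp (Re u) * norm u powr (- s)"
  using norm_powr_of_real[of u "- s"] by (simp add: hankel_fun_def norm_mult)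

lemma isCont_hankel_fun: "u \<notin> \<real>\<^sub>\<le>\<^sub>0 \<Longrightarrow> isCont (hankel_fun s) u"
  using hankel_fun_derivative DERIV_isCont by blast

text \<open>The upper half of the contour is the ray that leaves \<open>b\<close> at angle \<open>\<theta>\<close>. Since
  \<open>b * sin \<theta>\<close> is the distance from the origin to the line through the ray, the last assumption
  keeps \<open>norm u\<close> above \<open>1\<close>, so that negative powers of \<open>u\<close> are bounded by \<open>1\<close>.\<close>

locale wedge =
  fixes b \<theta> :: real
  assumes angle: "pi / 2 < \<theta>" "\<theta> < pi" and far: "1 \<le> b * sin \<theta>"
begin

lemma sin_pos: "0 < sin \<theta>" and cos_neg: "cos \<theta> < 0"
  using angle pi_gt_zero cos_gt_zero_pi[of "pi - \<theta>"] by (auto intro!: sin_gt_zero)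

lemma b_ge_1: "1 \<le> b"
proof (rule ccontr)
  assume "\<not> 1 \<le> b"
  then have "b * sin \<theta> < 1 * sin \<theta>" using sin_pos by (intro mult_strict_right_mono) auto
  then show False using far sin_le_one[of \<theta>] by simp
qed

definition ray :: "real \<Rightarrow> real \<Rightarrow> complex"
  where "ray a t = of_real a + of_real t * cis \<theta>"

lemma Re_ray[simp]: "Re (ray a t) = a + t * cos \<theta>" and Im_ray[simp]: "Im (ray a t) = t * sin \<theta>"
  by (simp_all add: ray_def)

lemma ray_not_nonpos:
  assumes "0 \<le> a" "0 \<le> t" "0 < a \<or> 0 < t"
  shows "ray a t \<notin> \<real>\<^sub>\<le>\<^sub>0"
  using assms sin_pos by (cases "t = 0") (auto simp: complex_nonpos_Reals_iff)

lemma norm_ray_le: "0 \<le> a \<Longrightarrow> 0 \<le> t \<Longrightarrow> norm (ray a t) \<le> a + t"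
  unfolding ray_def by (rule order_trans[OF norm_triangle_ineq]) (simp add: norm_mult)

text \<open>Rotating by \<open>- \<theta>\<close> makes the ray horizontal, at height \<open>- a * sin \<theta>\<close>.\<close>

lemma norm_ray_ge: "a * sin \<theta> \<le> norm (ray a t)"
proof -
  have "Im (ray a t * cis (- \<theta>)) = t * (sin \<theta> * cos \<theta>) - (a + t * cos \<theta>) * sin \<theta>"
    by (simp add: algebra_simps)
  also have "\<dots> = - (a * sin \<theta>)" by (simp add: algebra_simps)
  finally have "a * sin \<theta> \<le> \<bar>Im (ray a t * cis (- \<theta>))\<bar>" by simp
  also have "\<dots> \<le> norm (ray a t * cis (- \<theta>))" by (rule abs_Im_le_cmod)
  finally show ?thesis by (simp add: norm_mult)
qed

lemma ray_derivative: "((\<lambda>t. ray a t) has_vector_derivative cis \<theta>) (at t)"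
  unfolding ray_def by (auto intro!: derivative_eq_intros simp: has_vector_derivative_def scaleR_conv_of_real)

lemma ray_derivative_vertex: "((\<lambda>a. ray a t) has_vector_derivative 1) (at a)"
  unfolding ray_def by (auto intro!: derivative_eq_intros simp: has_vector_derivative_def scaleR_conv_of_real)

lemma isCont_ray: "isCont (\<lambda>t. ray a t) t" "isCont (\<lambda>a. ray a t) a"
  unfolding ray_def by (auto intro!: continuous_intros)

lemma norm_hankel_fun_ray_le:
  assumes "0 \<le> a" "a \<le> b" "0 < t" "1 \<le> a * sin \<theta> \<or> s \<le> 0"
  shows "norm (hankel_fun s (ray a t)) \<le> exp b * (exp (- ((- cos \<theta>) * t)) * (b + t) powr \<bar>s\<bar>)"
proof -
  have n: "ray a t \<noteq> 0" using ray_not_nonpos[of a t] assms by auto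
  have "norm (ray a t) powr (- s) \<le> (b + t) powr \<bar>s\<bar>"
  proof (cases "s \<le> 0")
    case True
    then show ?thesis using norm_ray_le[of a t] assms by (auto intro!: powr_mono2)
  next
    case False
    then have "1 \<le> norm (ray a t)" using norm_ray_ge[of a t] assms by auto
    then have "norm (ray a t) powr (- s) \<le> 1 powr (-s)" using False by (intro powr_mono2') auto
    also have "\<dots> \<le> (b + t) powr \<bar>s\<bar>" using b_ge_1 assms by (simp add: ge_one_powr_ge_zero)
    finally show ?thesis .
  qed
  then have "exp (Re (ray a t)) * norm (ray a t) powr (- s) \<le> (exp b * exp (t * cos \<theta>)) * (b + t) powr \<bar>s\<bar>"
    using assms by (intro mult_mono) (auto simp: exp_add[symmetric])
  then show ?thesis using n by (simp add: norm_hankel_fun mult_ac)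
qed

lemma integrable_bound_hankel:
  "0 \<le> m \<Longrightarrow> integrable (lborel_on {0<..}) (\<lambda>t. C * (exp (- ((- cos \<theta>) * t)) * (b + t) powr m))"
  using integrable_exp_decay[of b "- cos \<theta>" m 0 "1/2"] cos_neg b_ge_1 by (intro integrable_mult_right) auto

lemma tendsto_bound_hankel:
  assumes "0 \<le> m"
  shows "((\<lambda>t. C * (exp (- ((- cos \<theta>) * t)) * (b + t) powr m)) \<longlongrightarrow> 0) at_top"
proof -
  define c where "c = - cos \<theta>"
  have c: "0 < c" using cos_neg by (simp add: c_def)
  obtain A where A: "\<And>y. 0 < y \<Longrightarrow> y powr m \<le> exp (c / 2 * y + A)"
    using powr_le_exp_linear[of m "c / 2"] assms c by auto
  have "((\<lambda>t. exp (- (c * t)) * (b + t) powr m) \<longlongrightarrow> 0) at_top"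
  proof (rule tendsto_sandwich[of "\<lambda>_. 0"])
    show "\<forall>\<^sub>F t in at_top. exp (- (c * t)) * (b + t) powr m \<le> exp (- (c * t)) * exp (c / 2 * (b + t) + A)"
      using eventually_gt_at_top[of 0] by eventually_elim (use A b_ge_1 in auto)
    show "((\<lambda>t. exp (- (c * t)) * exp (c / 2 * (b + t) + A)) \<longlongrightarrow> 0) at_top"
      unfolding exp_add[symmetric] using c by real_asymp
  qed auto
  from tendsto_mult_right_zero[OF this, of C] show ?thesis by (simp add: c_def)
qed

lemma ray_measurable_on[measurable]:
  "(\<lambda>p. ray (fst p) (snd p)) \<in> borel_measurable (lborel_on A \<Otimes>\<^sub>M lborel_on B)"
  "ray a \<in> borel_measurable (lborel_on B)" "(\<lambda>a. ray a t) \<in> borel_measurable (lborel_on A)"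
  unfolding ray_def by measurable

lemma integrable_hankel_fun_ray:
  assumes "0 \<le> a" "a \<le> b" "1 \<le> a * sin \<theta> \<or> s \<le> 0"
  shows "integrable (lborel_on {0<..}) (\<lambda>t. hankel_fun s (ray a t))"
proof (rule Bochner_Integration.integrable_bound[OF integrable_bound_hankel[of "\<bar>s\<bar>" "exp b"]])
  show "AE t in lborel_on {0<..}. norm (hankel_fun s (ray a t)) \<le> norm (exp b * (exp (- ((- cos \<theta>) * t)) * (b + t) powr \<bar>s\<bar>))"
    using norm_hankel_fun_ray_le[of a _ s] assms by (intro AE_lborel_on) force+
qed auto

lemma hankel_fun_ray_tendsto:
  assumes "0 \<le> a" "a \<le> b" "1 \<le> a * sin \<theta> \<or> s \<le> 0"
  shows "((\<lambda>t. hankel_fun s (ray a t)) \<longlongrightarrow> 0) at_top"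
proof (rule Lim_null_comparison[OF _ tendsto_bound_hankel[of "\<bar>s\<bar>" "exp b"]])
  show "\<forall>\<^sub>F t in at_top. norm (hankel_fun s (ray a t)) \<le> exp b * (exp (- ((- cos \<theta>) * t)) * (b + t) powr \<bar>s\<bar>)"
    using eventually_gt_at_top[of 0] by eventually_elim (use norm_hankel_fun_ray_le[of a _ s] assms in force)
qed auto

lemma hankel_fun_ray_derivative:
  assumes "0 \<le> a" "0 \<le> t" "0 < a \<or> 0 < t"
  shows "((\<lambda>t. hankel_fun s (ray a t)) has_vector_derivative
           (hankel_fun s (ray a t) - of_real s * hankel_fun (s + 1) (ray a t)) * cis \<theta>) (at t)"
    and "((\<lambda>a. hankel_fun s (ray a t)) has_vector_derivative
           (hankel_fun s (ray a t) - of_real s * hankel_fun (s + 1) (ray a t))) (at a)"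
  using field_vector_diff_chain_at[OF ray_derivative hankel_fun_derivative[OF ray_not_nonpos[OF assms]]]
    field_vector_diff_chain_at[OF ray_derivative_vertex hankel_fun_derivative[OF ray_not_nonpos[OF assms]]]
  by (simp_all add: o_def mult.commute)

lemma isCont_hankel_fun_ray:
  assumes "0 \<le> a" "0 \<le> t" "0 < a \<or> 0 < t"
  shows "isCont (\<lambda>t. hankel_fun s (ray a t)) t" "isCont (\<lambda>a. hankel_fun s (ray a t)) a"
  using isCont_o2[OF isCont_ray(1) isCont_hankel_fun[OF ray_not_nonpos[OF assms]]]
    isCont_o2[OF isCont_ray(2) isCont_hankel_fun[OF ray_not_nonpos[OF assms]]] by auto

text \<open>The total derivative along the ray leaves only the boundary term at the vertex. That term is real,
  so it is invisible to the imaginary part; both the shift of the vertex and the recurrence in \<open>s\<close>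
  rest on this.\<close>

lemma integral_hankel_fun_ray_derivative:
  assumes "0 < a" "a \<le> b" "1 \<le> a * sin \<theta> \<or> s \<le> -1"
  shows "integral\<^sup>L (lborel_on {0<..})
      (\<lambda>t. (hankel_fun s (ray a t) - of_real s * hankel_fun (s + 1) (ray a t)) * cis \<theta>)
    = - of_real (exp a * a powr (- s))"
proof -
  have "integral\<^sup>L (lborel_on {0<..})
      (\<lambda>t. (hankel_fun s (ray a t) - of_real s * hankel_fun (s + 1) (ray a t)) * cis \<theta>)
    = 0 - hankel_fun s (ray a 0)"
  proof (rule integral_halfline_derivative[where F = "\<lambda>t. hankel_fun s (ray a t)"])
    show "((\<lambda>t. hankel_fun s (ray a t)) \<longlongrightarrow> hankel_fun s (ray a 0)) (at_right 0)"
      using isCont_hankel_fun_ray(1)[of a 0 s] assms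
      by (simp add: isCont_def filterlim_at_split)
    show "((\<lambda>t. hankel_fun s (ray a t)) \<longlongrightarrow> 0) at_top"
      using assms by (intro hankel_fun_ray_tendsto) auto
  qed (use assms in \<open>auto intro!: hankel_fun_ray_derivative isCont_hankel_fun_ray continuous_intros
        Bochner_Integration.integrable_diff integrable_mult_left integrable_mult_right integrable_hankel_fun_ray\<close>)
  then show ?thesis using assms by (simp add: ray_def hankel_fun_of_real)
qed

text \<open>Cauchy's theorem for the strip between the rays from \<open>0\<close> and from \<open>b\<close>, in the form of Fubini's
  theorem for the complex derivative of the integrand: integrating it horizontally gives the
  difference of the two ray integrals, integrating it along the rays gives real boundary terms. For
  \<open>s \<le> -1\<close> the derivative is bounded near the origin, so the vertex may be moved to \<open>0\<close>.\<close>

lemma hankel_vertex: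
  assumes s: "s \<le> -1"
  shows "Im (integral\<^sup>L (lborel_on {0<..}) (\<lambda>t. hankel_fun s (ray b t) * cis \<theta>))
       = Im (integral\<^sup>L (lborel_on {0<..}) (\<lambda>t. hankel_fun s (ray 0 t) * cis \<theta>))"
proof -
  let ?M1 = "lborel_on {0<..<b}" and ?M2 = "lborel_on {0<..}"
  interpret pair_sigma_finite ?M1 ?M2 by (intro pair_sigma_finite_lborel_on) auto
  interpret M1: finite_measure ?M1 by (rule finite_measure_lborel_on)
  define g where "g x t = (hankel_fun s (ray x t) - of_real s * hankel_fun (s + 1) (ray x t)) * cis \<theta>" for x t
  define C where "C t = exp b * (exp (- ((- cos \<theta>) * t)) * (b + t) powr \<bar>s\<bar>)
     + \<bar>s\<bar> * (exp b * (exp (- ((- cos \<theta>) * t)) * (b + t) powr \<bar>s + 1\<bar>))" for t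
  have C: "integrable ?M2 C" unfolding C_def
    by (intro Bochner_Integration.integrable_add integrable_mult_right[where c="\<bar>s\<bar>"] integrable_bound_hankel) auto
  have le: "norm (g x t) \<le> C t" if "0 < x" "x < b" "0 < t" for x t
  proof -
    have "norm (g x t) \<le> norm (hankel_fun s (ray x t)) + \<bar>s\<bar> * norm (hankel_fun (s + 1) (ray x t))"
      unfolding g_def by (simp add: norm_mult order_trans[OF norm_triangle_ineq4])
    also have "\<dots> \<le> C t"
      unfolding C_def using that s by (intro add_mono mult_left_mono norm_hankel_fun_ray_le) auto
    finally show ?thesis .
  qed
  have "integrable (?M1 \<Otimes>\<^sub>M ?M2) (\<lambda>p. g (fst p) (snd p))"
  proof (rule integrable_product_bound[OF _ _ C])
    show "(\<lambda>p. g (fst p) (snd p)) \<in> borel_measurable (?M1 \<Otimes>\<^sub>M ?M2)"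
      unfolding g_def by measurable
    show "integrable ?M1 (\<lambda>_. 1 :: real)" by simp
  qed (use le in \<open>auto simp: space_lborel_on\<close>)
  then have "integrable (?M1 \<Otimes>\<^sub>M ?M2) (case_prod g)" by (simp add: case_prod_unfold)
  from Fubini_integral[OF this]
  have F: "(\<integral>t. (\<integral>x. g x t \<partial>?M1) \<partial>?M2) = (\<integral>x. (\<integral>t. g x t \<partial>?M2) \<partial>?M1)" .
  have "(\<integral>x. g x t \<partial>?M1) = hankel_fun s (ray b t) * cis \<theta> - hankel_fun s (ray 0 t) * cis \<theta>" if t: "0 < t" for t
  proof (rule integral_interval_derivative[where F = "\<lambda>x. hankel_fun s (ray x t) * cis \<theta>"])
    show "integrable ?M1 (\<lambda>x. g x t)"
    proof (rule M1.integrable_const_bound)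
      show "AE x in ?M1. norm (g x t) \<le> C t" using le t by (intro AE_lborel_on) auto
    qed (simp add: g_def)
    show "((\<lambda>x. hankel_fun s (ray x t) * cis \<theta>) \<longlongrightarrow> hankel_fun s (ray 0 t) * cis \<theta>) (at_right 0)"
      using isCont_hankel_fun_ray(2)[of 0 t s] t
      by (intro tendsto_mult_right) (simp add: isCont_def filterlim_at_split)
    show "((\<lambda>x. hankel_fun s (ray x t) * cis \<theta>) \<longlongrightarrow> hankel_fun s (ray b t) * cis \<theta>) (at_left b)"
      using isCont_hankel_fun_ray(2)[of b t s] t b_ge_1
      by (intro tendsto_mult_right) (simp add: isCont_def filterlim_at_split)
  qed (use t b_ge_1 in \<open>auto simp: g_def intro!: has_vector_derivative_mult_left hankel_fun_ray_derivative(2) continuous_intros isCont_hankel_fun_ray(2)\<close>)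
  then have "(\<integral>t. (\<integral>x. g x t \<partial>?M1) \<partial>?M2) = (\<integral>t. hankel_fun s (ray b t) * cis \<theta> - hankel_fun s (ray 0 t) * cis \<theta> \<partial>?M2)"
    by (intro Bochner_Integration.integral_cong) (auto simp: space_lborel_on)
  also have "\<dots> = (\<integral>t. hankel_fun s (ray b t) * cis \<theta> \<partial>?M2) - (\<integral>t. hankel_fun s (ray 0 t) * cis \<theta> \<partial>?M2)"
    using s b_ge_1 by (intro Bochner_Integration.integral_diff integrable_mult_left integrable_hankel_fun_ray) auto
  finally have 1: "(\<integral>t. (\<integral>x. g x t \<partial>?M1) \<partial>?M2) = (\<integral>t. hankel_fun s (ray b t) * cis \<theta> \<partial>?M2) - (\<integral>t. hankel_fun s (ray 0 t) * cis \<theta> \<partial>?M2)" .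
  have "(\<integral>x. (\<integral>t. g x t \<partial>?M2) \<partial>?M1) = (\<integral>x. of_real (- (exp x * x powr (- s))) \<partial>?M1)"
    unfolding g_def using s
    by (intro Bochner_Integration.integral_cong refl, subst integral_hankel_fun_ray_derivative)
      (auto simp: space_lborel_on)
  also have "\<dots> = of_real (\<integral>x. - (exp x * x powr (- s)) \<partial>?M1)"
    by (rule integral_complex_of_real)
  finally have "Im (\<integral>x. (\<integral>t. g x t \<partial>?M2) \<partial>?M1) = 0" by simp
  then have "Im ((\<integral>t. hankel_fun s (ray b t) * cis \<theta> \<partial>?M2) - (\<integral>t. hankel_fun s (ray 0 t) * cis \<theta> \<partial>?M2)) = 0"
    unfolding F[symmetric] 1 .
  then show ?thesis unfolding minus_complex.sel by (simp only: eq_iff_diff_eq_0[symmetric])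
qed

text \<open>From the origin the ray integral is a Gamma integral with complex parameter
  \<open>- cis \<theta>\<close>; its argument is \<open>\<theta> - pi\<close>, which cancels \<open>\<theta>\<close> from the phase and
  leaves \<open>sin (pi * (1 - s))\<close>. The reflection formula finishes the computation.\<close>

lemma hankel_at_origin:
  assumes s: "s \<le> -1"
  shows "Im (integral\<^sup>L (lborel_on {0<..}) (\<lambda>t. hankel_fun s (ray 0 t) * cis \<theta>)) = pi * rGamma s"
proof -
  have c: "0 < Re (cis (\<theta> - pi))" using cos_neg by (simp add: cos_diff)
  have Ln_cis: "Ln (cis x) = \<i> * of_real x" if "- pi < x" "x \<le> pi" for x
    using that by (simp add: cis_conv_exp Ln_exp)
  have e: "hankel_fun s (ray 0 t) * cis \<theta> = cis ((1 - s) * \<theta>) * (of_real (t powr ((1 - s) - 1)) * exp (- (cis (\<theta> - pi) * of_real t)))"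
    if t: "0 < t" for t
  proof -
    have "(of_real t * cis \<theta>) powr (- of_real s) = exp (- of_real s * (of_real (ln t) + \<i> * of_real \<theta>))"
      using t angle by (simp add: powr_def Ln_times_of_real Ln_cis Ln_of_real)
    also have "- of_real s * (of_real (ln t) + \<i> * of_real \<theta>) = of_real (- s * ln t) + \<i> * of_real (- s * \<theta>)"
      by (simp add: algebra_simps)
    also have "exp \<dots> = of_real (t powr (- s)) * cis (- s * \<theta>)"
      using t by (simp only: exp_add cis_conv_exp exp_of_real powr_def) simp
    finally have p: "(of_real t * cis \<theta>) powr (- of_real s) = of_real (t powr (- s)) * cis (- s * \<theta>)" .
    have 1: "cis (- s * \<theta>) * cis \<theta> = cis ((1 - s) * \<theta>)"
      unfolding cis_mult by (simp add: algebra_simps)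
    have "- cis (\<theta> - pi) = cis \<theta>" by (simp add: complex_eq_iff cos_diff sin_diff)
    then have 2: "- (cis (\<theta> - pi) * of_real t) = of_real t * cis \<theta>"
      by (metis mult.commute mult_minus_left)
    have "hankel_fun s (ray 0 t) * cis \<theta> = exp (of_real t * cis \<theta>) * of_real (t powr (- s)) * (cis (- s * \<theta>) * cis \<theta>)"
      unfolding hankel_fun_def ray_def by (simp only: of_real_0 add_0 p mult.assoc)
    also have "\<dots> = cis ((1 - s) * \<theta>) * (of_real (t powr ((1 - s) - 1)) * exp (- (cis (\<theta> - pi) * of_real t)))"
      unfolding 1 2 by (simp only: mult_ac) simp
    finally show ?thesis .
  qed
  have "integral\<^sup>L (lborel_on {0<..}) (\<lambda>t. hankel_fun s (ray 0 t) * cis \<theta>)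
      = integral\<^sup>L (lborel_on {0<..}) (\<lambda>t. cis ((1 - s) * \<theta>) * (of_real (t powr ((1 - s) - 1)) * exp (- (cis (\<theta> - pi) * of_real t))))"
    using e by (intro Bochner_Integration.integral_cong) (auto simp: space_lborel_on)
  also have "\<dots> = cis ((1 - s) * \<theta>) * (of_real (Gamma (1 - s)) * cis (\<theta> - pi) powr (- of_real (1 - s)))"
    using has_bochner_integral_Gamma_complex[of "1 - s", OF _ c] s
    by (subst Bochner_Integration.integral_mult_right) (auto simp: has_bochner_integral_iff)
  also have "cis (\<theta> - pi) powr (- of_real (1 - s)) = cis ((1 - s) * (pi - \<theta>))"
    using angle by (simp add: powr_def Ln_cis cis_conv_exp algebra_simps)
  also have "cis ((1 - s) * \<theta>) * (of_real (Gamma (1 - s)) * cis ((1 - s) * (pi - \<theta>))) = of_real (Gamma (1 - s)) * cis ((1 - s) * pi)"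
    by (simp add: mult.left_commute[of "cis _"] cis_mult algebra_simps)
  finally have "Im (integral\<^sup>L (lborel_on {0<..}) (\<lambda>t. hankel_fun s (ray 0 t) * cis \<theta>)) = Gamma (1 - s) * sin (pi * (1 - s))"
    by (simp add: mult.commute)
  also have "sin (pi * (1 - s)) = pi * (rGamma s * rGamma (1 - s))"
  proof -
    have "complex_of_real (rGamma (1 - s) * rGamma (1 - (1 - s))) = of_real (sin (pi * (1 - s)) / pi)"
      using rGamma_reflection_complex[of "of_real (1 - s)"]
      by (simp only: of_real_mult rGamma_complex_of_real[symmetric] of_real_diff of_real_1 of_real_divide sin_of_real[symmetric])
    then have "rGamma (1 - s) * rGamma s = sin (pi * (1 - s)) / pi" 
      unfolding of_real_eq_iff by simp
    then show ?thesis by (simp add: field_simps)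
  qed
  also have "Gamma (1 - s) * (pi * (rGamma s * rGamma (1 - s))) = pi * rGamma s"
  proof -
    have "0 < Gamma (1 - s)" using s by (intro Gamma_real_pos) simp
    then have "Gamma (1 - s) * rGamma (1 - s) = 1" by (simp add: rGamma_inverse_Gamma)
    then show ?thesis by (metis mult.commute mult.left_commute mult_1)
  qed
  finally show ?thesis .
qed

lemma hankel_recurrence:
  "Im (integral\<^sup>L (lborel_on {0<..}) (\<lambda>t. hankel_fun s (ray b t) * cis \<theta>))
   = s * Im (integral\<^sup>L (lborel_on {0<..}) (\<lambda>t. hankel_fun (s + 1) (ray b t) * cis \<theta>))"
proof -
  have i: "integrable (lborel_on {0<..}) (\<lambda>t. hankel_fun x (ray b t) * cis \<theta>)" for x
    using far b_ge_1 by (intro integrable_mult_left integrable_hankel_fun_ray) auto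
  have "integral\<^sup>L (lborel_on {0<..})
      (\<lambda>t. (hankel_fun s (ray b t) - of_real s * hankel_fun (s + 1) (ray b t)) * cis \<theta>)
    = integral\<^sup>L (lborel_on {0<..}) (\<lambda>t. hankel_fun s (ray b t) * cis \<theta>)
      - of_real s * integral\<^sup>L (lborel_on {0<..}) (\<lambda>t. hankel_fun (s + 1) (ray b t) * cis \<theta>)"
  proof -
    have "(hankel_fun s u - of_real s * hankel_fun (s + 1) u) * cis \<theta>
        = hankel_fun s u * cis \<theta> - of_real s * (hankel_fun (s + 1) u * cis \<theta>)" for u
      by (simp add: algebra_simps)
    then show ?thesis
      by (simp only: Bochner_Integration.integral_diff[OF i integrable_mult_right[OF i]] integral_mult_right_zero)
  qed
  moreover have "Im (integral\<^sup>L (lborel_on {0<..})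
      (\<lambda>t. (hankel_fun s (ray b t) - of_real s * hankel_fun (s + 1) (ray b t)) * cis \<theta>)) = 0"
    using far b_ge_1 by (subst integral_hankel_fun_ray_derivative) auto
  ultimately show ?thesis by simp
qed

text \<open>The recurrence in \<open>s\<close>, which \<open>rGamma\<close> satisfies too, extends the case \<open>s \<le> -1\<close> to all
  non-integers and, upwards from \<open>s = 1\<close>, to the positive integers. The step from \<open>0\<close> to \<open>1\<close> is lost
  because there the recurrence only says \<open>0 = 0\<close>; it is replaced by continuity at \<open>s = 1\<close>.\<close>

lemma hankel_rGamma:
  "Im (integral\<^sup>L (lborel_on {0<..}) (\<lambda>t. hankel_fun s (ray b t) * cis \<theta>)) = pi * rGamma s"
proof -
  define K where "K s = Im (integral\<^sup>L (lborel_on {0<..}) (\<lambda>t. hankel_fun s (ray b t) * cis \<theta>))" for s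
  have rec: "K s = s * K (s + 1)" for s
    unfolding K_def by (rule hankel_recurrence)
  have base: "K s = pi * rGamma s" if "s \<le> -1" for s
    unfolding K_def using hankel_vertex[OF that] hankel_at_origin[OF that] by simp
  have step: "K s = pi * rGamma s" if "s \<le> -1 + real n" "s \<notin> \<int>" for n s
    using that
  proof (induction n arbitrary: s)
    case (Suc n)
    have "s - 1 \<notin> \<int>" using Suc.prems(2) by (metis Ints_1 Ints_add diff_add_cancel)
    with Suc have "K (s - 1) = pi * rGamma (s - 1)" by auto
    moreover have "K (s - 1) = (s - 1) * K s" using rec[of "s - 1"] by simp
    moreover have "rGamma (s - 1) = (s - 1) * rGamma s" using rGamma_plus1[of "s - 1"] by simp
    moreover have "s - 1 \<noteq> 0" using Suc.prems by auto
    ultimately show ?case by simp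
  qed (use base in auto)
  have nonint: "K s = pi * rGamma s" if "s \<notin> \<int>" for s
  proof -
    obtain n where "s + 1 \<le> real n" using real_arch_simple by blast
    then show ?thesis using that by (intro step[of s n]) auto
  qed
  have one: "K 1 = pi * rGamma 1"
  proof -
    \<comment> \<open>Non-integers in \<open>(1, 2)\<close>; the bound \<open>2\<close> on the exponent gives a common dominating function.\<close>
    define \<sigma> where "\<sigma> n = 1 + 1 / real (n + 2)" for n
    have \<sigma>: "\<sigma> \<longlonglongrightarrow> 1" unfolding \<sigma>_def by real_asymp
    have "(\<lambda>n. integral\<^sup>L (lborel_on {0<..}) (\<lambda>t. hankel_fun (\<sigma> n) (ray b t) * cis \<theta>))
       \<longlonglongrightarrow> integral\<^sup>L (lborel_on {0<..}) (\<lambda>t. hankel_fun 1 (ray b t) * cis \<theta>)"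
    proof (rule integral_dominated_convergence[where w = "\<lambda>t. exp b * (exp (- ((- cos \<theta>) * t)) * (b + t) powr 2)"])
      show "integrable (lborel_on {0<..}) (\<lambda>t. exp b * (exp (- ((- cos \<theta>) * t)) * (b + t) powr 2))"
        by (rule integrable_bound_hankel) simp
      have "(\<lambda>n. hankel_fun (\<sigma> n) (ray b t) * cis \<theta>) \<longlonglongrightarrow> hankel_fun 1 (ray b t) * cis \<theta>" if "0 < t" for t
      proof -
        have "ray b t \<noteq> 0" using ray_not_nonpos[of b t] b_ge_1 that by auto
        moreover have "(\<lambda>n. exp (ray b t) * exp (- of_real (\<sigma> n) * Ln (ray b t)) * cis \<theta>)
            \<longlonglongrightarrow> exp (ray b t) * exp (- of_real 1 * Ln (ray b t)) * cis \<theta>"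
          by (intro tendsto_intros \<sigma>)
        ultimately show ?thesis by (simp add: hankel_fun_def powr_def)
      qed
      then show "AE t in lborel_on {0<..}. (\<lambda>n. hankel_fun (\<sigma> n) (ray b t) * cis \<theta>) \<longlonglongrightarrow> hankel_fun 1 (ray b t) * cis \<theta>"
        by (intro AE_lborel_on) auto
      have "norm (hankel_fun (\<sigma> n) (ray b t) * cis \<theta>) \<le> exp b * (exp (- ((- cos \<theta>) * t)) * (b + t) powr 2)" if t: "0 < t" for n t
      proof -
        have "norm (hankel_fun (\<sigma> n) (ray b t)) \<le> exp b * (exp (- ((- cos \<theta>) * t)) * (b + t) powr \<bar>\<sigma> n\<bar>)"
          using t far b_ge_1 by (intro norm_hankel_fun_ray_le) auto
        also have "\<bar>\<sigma> n\<bar> \<le> 2" by (simp add: \<sigma>_def)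
        then have "exp b * (exp (- ((- cos \<theta>) * t)) * (b + t) powr \<bar>\<sigma> n\<bar>) \<le> exp b * (exp (- ((- cos \<theta>) * t)) * (b + t) powr 2)"
          using t b_ge_1 by (intro mult_left_mono powr_mono) auto
        finally show ?thesis by (simp add: norm_mult)
      qed
      then show "AE t in lborel_on {0<..}. norm (hankel_fun (\<sigma> n) (ray b t) * cis \<theta>) \<le> exp b * (exp (- ((- cos \<theta>) * t)) * (b + t) powr 2)" for n
        by (intro AE_lborel_on) auto
    qed measurable
    then have "(\<lambda>n. K (\<sigma> n)) \<longlonglongrightarrow> K 1" unfolding K_def by (rule tendsto_Im)
    moreover have "\<sigma> n \<notin> \<int>" for n
    proof
      assume "\<sigma> n \<in> \<int>"
      then obtain k where k: "\<sigma> n = of_int k" by (auto elim: Ints_cases)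
      have "1 < \<sigma> n" "\<sigma> n < 2" by (auto simp: \<sigma>_def)
      then have "1 < k" "k < 2" unfolding k by simp_all
      then show False by linarith
    qed
    ultimately have "(\<lambda>n. pi * rGamma (\<sigma> n)) \<longlonglongrightarrow> K 1" by (simp add: nonint)
    moreover have "(\<lambda>n. pi * rGamma (\<sigma> n)) \<longlonglongrightarrow> pi * rGamma 1"
    proof -
      have "isCont (rGamma :: real \<Rightarrow> real) 1" by (intro continuous_intros)
      then show ?thesis by (intro tendsto_mult_left isCont_tendsto_compose[OF _ \<sigma>])
    qed
    ultimately show ?thesis by (rule LIMSEQ_unique)
  qed
  have pos: "K (real (Suc n)) = pi * rGamma (real (Suc n))" for n
  proof (induction n)
    case (Suc n)
    have "rGamma (real (Suc n)) = real (Suc n) * rGamma (real (Suc n) + 1)"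
      using rGamma_plus1[of "real (Suc n)"] by simp
    then show ?case using Suc rec[of "real (Suc n)"] by (simp add: add.commute)
  qed (use one in simp)
  have "K s = pi * rGamma s"
  proof (cases "s \<in> \<int>")
    case True
    then obtain k where k: "s = of_int k" by (auto elim: Ints_cases)
    consider "k \<le> -1" | "k = 0" | "1 \<le> k" by linarith
    then show ?thesis
    proof cases
      case 1
      then show ?thesis by (intro base) (simp add: k)
    next
      case 2
      then show ?thesis using rec[of 0] by (simp add: k)
    next
      case 3
      then have "s = real (Suc (nat (k - 1)))" by (simp add: k)
      then show ?thesis using pos by metis
    qed
  qed (rule nonint)
  then show ?thesis by (simp add: K_def)
qed

end

section \<open>The Laplace transform of the Wright function\<close>

lemma hankel_fun_powr:
  assumes "u \<noteq> 0"
  shows "hankel_fun (1 - \<nu> * (real r + 1)) u = hankel_fun (1 - \<nu>) u * (u powr of_real \<nu>) ^ r"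
    and "hankel_fun (\<nu> * real r + 1) u = hankel_fun (1 - \<nu>) u / (u powr of_real \<nu>) ^ Suc r"
proof -
  have "hankel_fun (1 - \<nu> * (real r + 1)) u = exp u * u powr (- of_real (1 - \<nu>) + of_nat r * of_real \<nu>)"
    by (simp add: hankel_fun_def algebra_simps)
  then show "hankel_fun (1 - \<nu> * (real r + 1)) u = hankel_fun (1 - \<nu>) u * (u powr of_real \<nu>) ^ r"
    using assms unfolding powr_add powr_power[OF assms] by (simp add: hankel_fun_def)
  have "hankel_fun (\<nu> * real r + 1) u = exp u * u powr (- of_real (1 - \<nu>) - of_nat (Suc r) * of_real \<nu>)"
    by (simp add: hankel_fun_def algebra_simps)
  then show "hankel_fun (\<nu> * real r + 1) u = hankel_fun (1 - \<nu>) u / (u powr of_real \<nu>) ^ Suc r"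
    using assms unfolding powr_diff powr_power[OF assms] by (simp add: hankel_fun_def)
qed

text \<open>The additional bound on \<open>\<theta>\<close> keeps \<open>u powr \<nu>\<close> in the right half plane along the ray.\<close>

locale wright_wedge = wedge +
  fixes \<nu> :: real
  assumes \<nu>: "0 < \<nu>" "\<nu> < 1" "\<nu> * \<theta> < pi / 2"
begin

text \<open>A lower bound for \<open>Re (u powr \<nu>)\<close> along the ray, and hence a rate of exponential decay in
  \<open>\<xi>\<close> for the Wright function. It tends to infinity with \<open>b\<close>.\<close>

definition decay :: real where "decay = (b * sin \<theta>) powr \<nu> * cos (\<nu> * \<theta>)"

definition ray_pow :: "real \<Rightarrow> complex" where "ray_pow t = ray b t powr of_real \<nu>"

definition ray_weight :: "real \<Rightarrow> complex" where "ray_weight t = hankel_fun (1 - \<nu>) (ray b t) * cis \<theta>"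

lemma ray_pow_measurable[measurable]: "ray_pow \<in> borel_measurable (lborel_on A)"
  unfolding ray_pow_def by measurable

lemma ray_weight_measurable[measurable]: "ray_weight \<in> borel_measurable (lborel_on A)"
  unfolding ray_weight_def by measurable

lemma decay_pos: "0 < decay"
proof -
  have "0 < \<theta>" using angle pi_gt_zero by linarith
  then show ?thesis unfolding decay_def using far \<nu> by (intro mult_pos_pos cos_gt_zero) auto
qed

lemma ray_nonzero: "0 < t \<Longrightarrow> ray b t \<noteq> 0"
  using ray_not_nonpos[of b t] b_ge_1 by auto

text \<open>The modulus of \<open>u\<close> is at least \<open>b * sin \<theta>\<close> and its argument lies between \<open>0\<close> and
  \<open>\<theta>\<close>, because \<open>u * cis (- \<theta>)\<close> has negative imaginary part.\<close>

lemma Re_ray_pow_ge: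
  assumes t: "0 < t"
  shows "decay \<le> Re (ray_pow t)"
proof -
  define u where "u = ray b t"
  define \<phi> where "\<phi> = Im (Ln u)"
  have u: "u \<noteq> 0" using ray_nonzero[OF t] by (simp add: u_def)
  have "0 < Im u" using t sin_pos by (simp add: u_def)
  then have \<phi>: "0 < \<phi>" "\<phi> < pi" using Im_Ln_pos_lt_imp by (auto simp: \<phi>_def)
  have u_eq: "u = of_real (norm u) * cis \<phi>"
  proof -
    have "u = exp (Ln u)" using u by simp
    also have "Ln u = of_real (Re (Ln u)) + \<i> * of_real \<phi>" unfolding \<phi>_def by (rule complex_eq)
    also have "exp \<dots> = of_real (exp (Re (Ln u))) * cis \<phi>"
      by (simp only: exp_add cis_conv_exp exp_of_real)
    also have "exp (Re (Ln u)) = norm u" using u by simp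
    finally show ?thesis .
  qed
  have "norm u * sin (\<phi> - \<theta>) = Im (u * cis (- \<theta>))"
    by (subst (2) u_eq) (simp add: cis_mult mult.assoc)
  also have "\<dots> = - (b * sin \<theta>)" by (simp add: u_def algebra_simps)
  also have "\<dots> < 0" using far by simp
  finally have "sin (\<phi> - \<theta>) < 0" using u by (simp add: mult_less_0_iff)
  then have "\<phi> \<le> \<theta>" using \<phi> angle sin_ge_zero[of "\<phi> - \<theta>"] by force
  then have "cos (\<nu> * \<theta>) \<le> cos (\<nu> * \<phi>)" using \<phi> \<nu> angle pi_gt_zero
    by (intro cos_monotone_0_pi_le mult_left_mono) auto
  moreover have "0 \<le> cos (\<nu> * \<theta>)" using decay_pos by (auto simp: decay_def zero_less_mult_iff)
  moreover have "(b * sin \<theta>) powr \<nu> \<le> norm u powr \<nu>"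
    using norm_ray_ge[of b t] far \<nu> by (intro powr_mono2) (auto simp: u_def)
  ultimately have "decay \<le> norm u powr \<nu> * cos (\<nu> * \<phi>)"
    unfolding decay_def by (intro mult_mono) auto
  also have "\<dots> = Re (ray_pow t)"
    using u by (simp add: ray_pow_def u_def[symmetric] powr_def Re_exp \<phi>_def)
  finally show ?thesis .
qed

lemma norm_ray_pow_ge: "0 < t \<Longrightarrow> decay \<le> norm (ray_pow t)"
  using Re_ray_pow_ge complex_Re_le_cmod order_trans by blast

lemma ray_pow_nonzero: "0 < t \<Longrightarrow> ray_pow t \<noteq> 0"
  using norm_ray_pow_ge[of t] decay_pos by auto

lemma norm_ray_pow_le: "0 < t \<Longrightarrow> norm (ray_pow t) \<le> (b + t) powr \<nu>"
  using norm_ray_le[of b t] b_ge_1 ray_nonzero[of t] \<nu> by (auto simp: ray_pow_def norm_powr_of_real intro!: powr_mono2)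

lemma norm_ray_weight_le: "0 < t \<Longrightarrow> norm (ray_weight t) \<le> exp b * (exp (- ((- cos \<theta>) * t)) * (b + t) powr (1 - \<nu>))"
  using norm_hankel_fun_ray_le[of b t "1 - \<nu>"] far b_ge_1 \<nu> by (simp add: ray_weight_def norm_mult)

lemma integrable_ray_weight_exp:
  assumes "0 \<le> K"
  shows "integrable (lborel_on {0<..}) (\<lambda>t. norm (ray_weight t) * exp (K * norm (ray_pow t)))"
proof -
  have "integrable (lborel_on {0<..}) (\<lambda>t. exp b * (exp (- ((- cos \<theta>) * t)) * (b + t) powr (1 - \<nu>) * exp (K * (b + t) powr \<nu>)))"
    using integrable_exp_decay[of b "- cos \<theta>" "1 - \<nu>" K \<nu>] b_ge_1 cos_neg \<nu> assms by auto
  then show ?thesis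
  proof (rule Bochner_Integration.integrable_bound)
    have "norm (ray_weight t) * exp (K * norm (ray_pow t)) \<le> exp b * (exp (- ((- cos \<theta>) * t)) * (b + t) powr (1 - \<nu>)) * exp (K * (b + t) powr \<nu>)"
      if "0 < t" for t
      using norm_ray_weight_le[OF that] norm_ray_pow_le[OF that] assms by (intro mult_mono) (auto intro: mult_left_mono)
    then show "AE t in lborel_on {0<..}. norm (norm (ray_weight t) * exp (K * norm (ray_pow t)))
       \<le> norm (exp b * (exp (- ((- cos \<theta>) * t)) * (b + t) powr (1 - \<nu>) * exp (K * (b + t) powr \<nu>)))"
      by (intro AE_lborel_on) (auto simp: mult.assoc)
  qed measurable
qed

lemma integrable_norm_ray_weight: "integrable (lborel_on {0<..}) (\<lambda>t. norm (ray_weight t))"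
  using integrable_ray_weight_exp[of 0] by simp

text \<open>The coefficients of the Wright series and of the Mittag-Leffler series are nonnegative and negative
  power moments of \<open>u powr \<nu>\<close> with respect to the same weight on the ray.\<close>

lemma hankel_ray_weight:
  "Im (integral\<^sup>L (lborel_on {0<..}) (\<lambda>t. ray_weight t * ray_pow t ^ r)) = pi * rGamma (1 - \<nu> * (real r + 1))"
  "Im (integral\<^sup>L (lborel_on {0<..}) (\<lambda>t. ray_weight t / ray_pow t ^ Suc r)) = pi * rGamma (\<nu> * real r + 1)"
proof -
  have "integral\<^sup>L (lborel_on {0<..}) (\<lambda>t. ray_weight t * ray_pow t ^ r)
      = integral\<^sup>L (lborel_on {0<..}) (\<lambda>t. hankel_fun (1 - \<nu> * (real r + 1)) (ray b t) * cis \<theta>)"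
    using ray_nonzero
    by (intro Bochner_Integration.integral_cong) (auto simp: space_lborel_on ray_weight_def ray_pow_def hankel_fun_powr(1))
  then show "Im (integral\<^sup>L (lborel_on {0<..}) (\<lambda>t. ray_weight t * ray_pow t ^ r)) = pi * rGamma (1 - \<nu> * (real r + 1))"
    by (simp only: hankel_rGamma)
  have "integral\<^sup>L (lborel_on {0<..}) (\<lambda>t. ray_weight t / ray_pow t ^ Suc r)
      = integral\<^sup>L (lborel_on {0<..}) (\<lambda>t. hankel_fun (\<nu> * real r + 1) (ray b t) * cis \<theta>)"
    using ray_nonzero
    by (intro Bochner_Integration.integral_cong) (auto simp: space_lborel_on ray_weight_def ray_pow_def hankel_fun_powr(2) simp del: power_Suc)
  then show "Im (integral\<^sup>L (lborel_on {0<..}) (\<lambda>t. ray_weight t / ray_pow t ^ Suc r)) = pi * rGamma (\<nu> * real r + 1)"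
    by (simp only: hankel_rGamma)
qed

text \<open>The sum may be taken under the integral because \<open>exp (\<bar>\<xi>\<bar> * norm u powr \<nu>)\<close>, which dominates
  the partial sums, is absorbed by the decay of \<open>exp u\<close> along the ray.\<close>

lemma wright_eq_integral:
  "wright (- \<nu>) (1 - \<nu>) (- \<xi>) = Im (integral\<^sup>L (lborel_on {0<..}) (\<lambda>t. ray_weight t * exp (- (of_real \<xi> * ray_pow t)))) / pi"
proof -
  define f where "f r t = ray_weight t * ray_pow t ^ r * ((- of_real \<xi>) ^ r / fact r)" for r t
  have le: "norm (\<Sum>r<n. f r t) \<le> norm (ray_weight t) * exp (\<bar>\<xi>\<bar> * norm (ray_pow t))" for n t
  proof -
    have "norm (\<Sum>r<n. f r t) \<le> (\<Sum>r<n. norm (f r t))" by (rule norm_sum)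
    also have "\<dots> = norm (ray_weight t) * (\<Sum>r<n. (\<bar>\<xi>\<bar> * norm (ray_pow t)) ^ r / fact r)"
      by (simp add: f_def sum_distrib_left norm_mult norm_divide norm_power power_mult_distrib mult_ac)
    also have "\<dots> \<le> norm (ray_weight t) * exp (\<bar>\<xi>\<bar> * norm (ray_pow t))"
      by (intro mult_left_mono sum_power_div_fact_le_exp) auto
    finally show ?thesis .
  qed
  have int: "integrable (lborel_on {0<..}) (f r)" for r
  proof (rule Bochner_Integration.integrable_bound[OF integrable_ray_weight_exp[of "\<bar>\<xi>\<bar>"]])
    have "norm (f r t) \<le> norm (norm (ray_weight t) * exp (\<bar>\<xi>\<bar> * norm (ray_pow t)))" for t
    proof -
      have "norm (f r t) = norm (ray_weight t) * ((\<bar>\<xi>\<bar> * norm (ray_pow t)) ^ r / fact r)"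
        by (simp add: f_def norm_mult norm_divide norm_power power_mult_distrib)
      also have "(\<bar>\<xi>\<bar> * norm (ray_pow t)) ^ r / fact r \<le> (\<Sum>i<Suc r. (\<bar>\<xi>\<bar> * norm (ray_pow t)) ^ i / fact i)"
        by (intro member_le_sum) auto
      also have "\<dots> \<le> exp (\<bar>\<xi>\<bar> * norm (ray_pow t))" by (intro sum_power_div_fact_le_exp) auto
      finally show ?thesis by (simp add: mult_left_mono)
    qed
    then show "AE t in lborel_on {0<..}. norm (f r t) \<le> norm (norm (ray_weight t) * exp (\<bar>\<xi>\<bar> * norm (ray_pow t)))" by simp
  qed (auto simp: f_def[abs_def])
  have "(\<lambda>r. f r t) sums (ray_weight t * exp (- (of_real \<xi> * ray_pow t)))" for t
  proof -
    have "(\<lambda>r. ray_weight t * ((- (of_real \<xi> * ray_pow t)) ^ r /\<^sub>R fact r)) sums (ray_weight t * exp (- (of_real \<xi> * ray_pow t)))"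
      by (intro sums_mult exp_converges)
    moreover have "ray_weight t * ((- (of_real \<xi> * ray_pow t)) ^ r /\<^sub>R fact r) = f r t" for r
      by (simp add: f_def scaleR_conv_of_real divide_inverse power_mult_distrib power_minus[of "_ * _"] power_minus[of "of_real _"] mult_ac)
    ultimately show ?thesis by simp
  qed
  then have "(\<lambda>r. integral\<^sup>L (lborel_on {0<..}) (f r)) sums integral\<^sup>L (lborel_on {0<..}) (\<lambda>t. ray_weight t * exp (- (of_real \<xi> * ray_pow t)))"
    using le by (intro sums_integral_dominated(2)[OF int integrable_ray_weight_exp[of "\<bar>\<xi>\<bar>"]]) auto
  then have "(\<lambda>r. Im (integral\<^sup>L (lborel_on {0<..}) (f r))) sums Im (integral\<^sup>L (lborel_on {0<..}) (\<lambda>t. ray_weight t * exp (- (of_real \<xi> * ray_pow t))))"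
    by (rule bounded_linear.sums[OF bounded_linear_Im])
  moreover have "Im (integral\<^sup>L (lborel_on {0<..}) (f r)) = pi * ((- \<xi>) ^ r * rGamma (- \<nu> * real r + (1 - \<nu>)) / fact r)" for r
  proof -
    have "integral\<^sup>L (lborel_on {0<..}) (f r) = integral\<^sup>L (lborel_on {0<..}) (\<lambda>t. ray_weight t * ray_pow t ^ r) * of_real ((- \<xi>) ^ r / fact r)"
      unfolding f_def by simp
    then have "Im (integral\<^sup>L (lborel_on {0<..}) (f r)) = pi * rGamma (1 - \<nu> * (real r + 1)) * ((- \<xi>) ^ r / fact r)"
      unfolding hankel_ray_weight(1)[symmetric] by (simp only: Im_complex_of_real Re_complex_of_real times_complex.sel mult_zero_right add_0_right add_0_left)
    also have "1 - \<nu> * (real r + 1) = - \<nu> * real r + (1 - \<nu>)" by (simp add: algebra_simps)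
    finally show ?thesis by simp
  qed
  ultimately have "(\<lambda>r. pi * ((- \<xi>) ^ r * rGamma (- \<nu> * real r + (1 - \<nu>)) / fact r)) sums Im (integral\<^sup>L (lborel_on {0<..}) (\<lambda>t. ray_weight t * exp (- (of_real \<xi> * ray_pow t))))"
    by simp
  from sums_divide[OF this, of pi] show ?thesis
    by (simp add: wright_def sums_iff)
qed

text \<open>Fubini's theorem applies because the integrand decays in \<open>\<xi>\<close> at rate \<open>z + decay\<close>; the inner
  integral is \<open>1 / (z + u powr \<nu>)\<close>. Its expansion in powers of \<open>z / u powr \<nu>\<close> is dominated by
  a geometric series, as \<open>norm (u powr \<nu>) \<ge> decay > \<bar>z\<bar>\<close>.\<close>

lemma laplace_wright:
  assumes z: "\<bar>z\<bar> < decay"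
  shows "integrable (lborel_on {0<..}) (\<lambda>\<xi>. exp (- (z * \<xi>)) * wright (- \<nu>) (1 - \<nu>) (- \<xi>))" (is ?int)
    and "(\<lambda>n. (- z) ^ n * rGamma (\<nu> * real n + 1)) sums
      integral\<^sup>L (lborel_on {0<..}) (\<lambda>\<xi>. exp (- (z * \<xi>)) * wright (- \<nu>) (1 - \<nu>) (- \<xi>))" (is ?sums)
proof -
  let ?M = "lborel_on {0<..}"
  interpret pair_sigma_finite ?M ?M by (intro pair_sigma_finite_lborel_on) auto
  define \<Phi> where "\<Phi> \<xi> t = ray_weight t * exp (- ((of_real z + ray_pow t) * of_real \<xi>))" for \<xi> t
  have "integrable ?M (\<lambda>u. u powr (1 - 1) * exp (- ((z + decay) * u)))"
    using z by (intro integrable_lborel_on_Gamma) auto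
  also have "?this \<longleftrightarrow> integrable ?M (\<lambda>u. exp (- ((z + decay) * u)))"
    by (intro Bochner_Integration.integrable_cong) (auto simp: space_lborel_on)
  finally have e: "integrable ?M (\<lambda>u. exp (- ((z + decay) * u)))" .
  have \<Phi>: "integrable (?M \<Otimes>\<^sub>M ?M) (\<lambda>p. \<Phi> (fst p) (snd p))"
  proof (rule integrable_product_bound[OF _ e integrable_norm_ray_weight])
    show "(\<lambda>p. \<Phi> (fst p) (snd p)) \<in> borel_measurable (?M \<Otimes>\<^sub>M ?M)"
      unfolding \<Phi>_def ray_pow_def ray_weight_def by measurable
    fix \<xi> t assume "\<xi> \<in> space ?M" "t \<in> space ?M"
    then have *: "0 < \<xi>" "0 < t" by (auto simp: space_lborel_on)
    have "norm (\<Phi> \<xi> t) = norm (ray_weight t) * exp (- ((z + Re (ray_pow t)) * \<xi>))"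
      by (simp add: \<Phi>_def norm_mult)
    also have "\<dots> \<le> norm (ray_weight t) * exp (- ((z + decay) * \<xi>))"
      using * Re_ray_pow_ge[of t] by (intro mult_left_mono) auto
    finally show "norm (\<Phi> (fst (\<xi>, t)) (snd (\<xi>, t))) \<le> exp (- ((z + decay) * \<xi>)) * norm (ray_weight t)"
      by (simp add: mult.commute)
  qed
  then have \<Phi>': "integrable (?M \<Otimes>\<^sub>M ?M) (case_prod \<Phi>)" by (simp add: case_prod_unfold)
  have inner: "exp (- (z * \<xi>)) * wright (- \<nu>) (1 - \<nu>) (- \<xi>) = Im (\<integral>t. \<Phi> \<xi> t \<partial>?M) / pi" for \<xi>
  proof -
    have "(\<integral>t. \<Phi> \<xi> t \<partial>?M) = (\<integral>t. of_real (exp (- (z * \<xi>))) * (ray_weight t * exp (- (of_real \<xi> * ray_pow t))) \<partial>?M)"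
      by (simp add: \<Phi>_def exp_of_real[symmetric] exp_add[symmetric] exp_diff exp_minus ring_distribs mult_ac divide_simps)
    also have "\<dots> = of_real (exp (- (z * \<xi>))) * (\<integral>t. ray_weight t * exp (- (of_real \<xi> * ray_pow t)) \<partial>?M)"
      by (rule integral_mult_right_zero)
    finally show ?thesis by (simp add: wright_eq_integral)
  qed
  have i1: "integrable ?M (\<lambda>\<xi>. \<integral>t. \<Phi> \<xi> t \<partial>?M)"
    using integrable_fst'[OF \<Phi>] by simp
  show ?int unfolding inner by (intro integrable_divide_zero integrable_Im i1)
  have L: "integral\<^sup>L ?M (\<lambda>\<xi>. exp (- (z * \<xi>)) * wright (- \<nu>) (1 - \<nu>) (- \<xi>)) = Im (\<integral>\<xi>. (\<integral>t. \<Phi> \<xi> t \<partial>?M) \<partial>?M) / pi"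
    unfolding inner using i1 by simp
  have "(\<integral>\<xi>. (\<integral>t. \<Phi> \<xi> t \<partial>?M) \<partial>?M) = (\<integral>t. (\<integral>\<xi>. \<Phi> \<xi> t \<partial>?M) \<partial>?M)"
    using Fubini_integral[OF \<Phi>'] by simp
  also have "\<dots> = (\<integral>t. ray_weight t / (of_real z + ray_pow t) \<partial>?M)"
  proof (intro Bochner_Integration.integral_cong refl)
    fix t assume "t \<in> space ?M"
    then have t: "0 < t" by (simp add: space_lborel_on)
    have c: "0 < Re (of_real z + ray_pow t)" using Re_ray_pow_ge[OF t] z by auto
    have "(\<integral>\<xi>. \<Phi> \<xi> t \<partial>?M) = ray_weight t * (\<integral>\<xi>. exp (- ((of_real z + ray_pow t) * of_real \<xi>)) \<partial>?M)"
      unfolding \<Phi>_def by (rule integral_mult_right_zero)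
    also have "(\<integral>\<xi>. exp (- ((of_real z + ray_pow t) * of_real \<xi>)) \<partial>?M) = (\<integral>\<xi>. of_real (\<xi> powr (1 - 1)) * exp (- ((of_real z + ray_pow t) * of_real \<xi>)) \<partial>?M)"
      by (intro Bochner_Integration.integral_cong refl) (simp add: space_lborel_on)
    also have "\<dots> = of_real (Gamma 1) * (of_real z + ray_pow t) powr (- of_real 1)"
      using has_bochner_integral_Gamma_complex[of 1, OF _ c] by (simp add: has_bochner_integral_iff)
    also have "\<dots> = 1 / (of_real z + ray_pow t)"
    proof -
      have "of_real z + ray_pow t \<noteq> 0" using c by (metis less_irrefl zero_complex.sel(1))
      then show ?thesis by (simp add: powr_def exp_minus divide_inverse)
    qed
    finally show "(\<integral>\<xi>. \<Phi> \<xi> t \<partial>?M) = ray_weight t / (of_real z + ray_pow t)" by simp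
  qed
  finally have L2: "(\<integral>\<xi>. (\<integral>t. \<Phi> \<xi> t \<partial>?M) \<partial>?M) = (\<integral>t. ray_weight t / (of_real z + ray_pow t) \<partial>?M)" .
  define f where "f n t = ray_weight t / ray_pow t ^ Suc n * of_real ((- z) ^ n)" for n t
  define G where "G = 1 / (1 - \<bar>z\<bar> / decay) / decay"
  have geo: "(\<lambda>i. (\<bar>z\<bar> / decay) ^ i / decay) sums G"
    unfolding G_def using z decay_pos by (intro sums_divide geometric_sums) auto
  have f_le: "norm (f n t) \<le> norm (ray_weight t) * ((\<bar>z\<bar> / decay) ^ n / decay)" if t: "0 < t" for n t
  proof -
    have "norm (f n t) = norm (ray_weight t) * (\<bar>z\<bar> ^ n / norm (ray_pow t) ^ Suc n)"
      by (simp add: f_def norm_mult norm_divide norm_power)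
    also have "\<dots> \<le> norm (ray_weight t) * (\<bar>z\<bar> ^ n / decay ^ Suc n)"
      using norm_ray_pow_ge[OF t] decay_pos ray_pow_nonzero[OF t] by (intro mult_left_mono divide_left_mono power_mono mult_pos_pos) auto
    finally show ?thesis by (simp add: power_divide mult.commute)
  qed
  have le: "norm (\<Sum>i<n. f i t) \<le> norm (ray_weight t) * G" if t: "0 < t" for n t
  proof -
    have "norm (\<Sum>i<n. f i t) \<le> (\<Sum>i<n. norm (ray_weight t) * ((\<bar>z\<bar> / decay) ^ i / decay))"
      by (intro sum_norm_le f_le t)
    also have "\<dots> = norm (ray_weight t) * (\<Sum>i<n. (\<bar>z\<bar> / decay) ^ i / decay)" by (simp add: sum_distrib_left)
    also have "(\<Sum>i<n. (\<bar>z\<bar> / decay) ^ i / decay) \<le> G"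
      unfolding sums_unique[OF geo] using decay_pos by (intro sum_le_suminf sums_summable[OF geo]) auto
    finally show ?thesis by (simp add: mult_left_mono)
  qed
  have s: "(\<lambda>n. f n t) sums (ray_weight t / (of_real z + ray_pow t))" if t: "0 < t" for t
  proof -
    have "norm (- of_real z / ray_pow t) < 1"
      using norm_ray_pow_ge[OF t] z decay_pos ray_pow_nonzero[OF t] by (simp add: norm_divide divide_less_eq)
    from sums_mult[OF geometric_sums[OF this], of "ray_weight t / ray_pow t"]
    have "(\<lambda>n. ray_weight t / ray_pow t * (- of_real z / ray_pow t) ^ n) sums (ray_weight t / ray_pow t * (1 / (1 - - of_real z / ray_pow t)))" .
    moreover have "ray_weight t / ray_pow t * (- of_real z / ray_pow t) ^ n = f n t" for n
      unfolding f_def power_divide by simp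
    moreover have "ray_weight t / ray_pow t * (1 / (1 - - of_real z / ray_pow t)) = ray_weight t / (of_real z + ray_pow t)"
      using ray_pow_nonzero[OF t] by (simp add: divide_simps add.commute)
    ultimately show ?thesis by (simp only:)
  qed
  have f_int: "integrable ?M (f n)" for n
  proof (rule Bochner_Integration.integrable_bound)
    show "integrable ?M (\<lambda>t. norm (ray_weight t) * ((\<bar>z\<bar> / decay) ^ n / decay))" by (intro integrable_mult_left integrable_norm_ray_weight)
    show "AE t in ?M. norm (f n t) \<le> norm (norm (ray_weight t) * ((\<bar>z\<bar> / decay) ^ n / decay))"
      using f_le decay_pos by (intro AE_lborel_on) (auto simp: abs_mult)
  qed (simp add: f_def[abs_def])
  have "(\<lambda>n. integral\<^sup>L ?M (f n)) sums (\<integral>t. ray_weight t / (of_real z + ray_pow t) \<partial>?M)"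
  proof (rule sums_integral_dominated(2)[OF f_int])
    show "integrable ?M (\<lambda>t. norm (ray_weight t) * G)" by (intro integrable_mult_left integrable_norm_ray_weight)
  qed (use s le in \<open>auto intro!: AE_lborel_on\<close>)
  from sums_divide[OF bounded_linear.sums[OF bounded_linear_Im this], of pi]
  have "(\<lambda>n. Im (integral\<^sup>L ?M (f n)) / pi) sums (Im (\<integral>t. ray_weight t / (of_real z + ray_pow t) \<partial>?M) / pi)" .
  moreover have "Im (integral\<^sup>L ?M (f n)) / pi = (- z) ^ n * rGamma (\<nu> * real n + 1)" for n
  proof -
    have "integral\<^sup>L ?M (f n) = (\<integral>t. ray_weight t / ray_pow t ^ Suc n \<partial>?M) * of_real ((- z) ^ n)"
      unfolding f_def by (rule integral_mult_left_zero)
    then have "Im (integral\<^sup>L ?M (f n)) = pi * rGamma (\<nu> * real n + 1) * (- z) ^ n"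
      unfolding hankel_ray_weight(2)[symmetric] by (simp only: Im_complex_of_real Re_complex_of_real times_complex.sel mult_zero_right add_0_right add_0_left)
    then show ?thesis by simp
  qed
  ultimately show ?sums unfolding L L2 by simp
qed

end

text \<open>The Laplace transform exists at every real \<open>z\<close>, because the vertex \<open>b\<close> of the contour is free and
  \<open>decay\<close> can be made larger than \<open>\<bar>z\<bar>\<close>.\<close>

lemma laplace_transform_wright:
  fixes \<nu> z :: real
  assumes \<nu>: "0 < \<nu>" "\<nu> < 1"
  shows "integrable (lborel_on {0<..}) (\<lambda>\<xi>. exp (- (z * \<xi>)) * wright (- \<nu>) (1 - \<nu>) (- \<xi>))"
    and "(\<lambda>n. (- z) ^ n * rGamma (\<nu> * real n + 1)) sums
      integral\<^sup>L (lborel_on {0<..}) (\<lambda>\<xi>. exp (- (z * \<xi>)) * wright (- \<nu>) (1 - \<nu>) (- \<xi>))"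
proof -
  \<comment> \<open>This angle satisfies \<open>pi / 2 < \<theta>\<close> and \<open>\<nu> * \<theta> < pi / 2\<close> exactly because \<open>\<nu> < 1\<close>.\<close>
  define \<theta> where "\<theta> = pi / (1 + \<nu>)"
  have \<theta>: "pi / 2 < \<theta>" "\<theta> < pi" "\<nu> * \<theta> < pi / 2" "0 < \<nu> * \<theta>"
    using \<nu> by (auto simp: \<theta>_def field_simps)
  have sin: "0 < sin \<theta>" using \<theta> pi_gt_zero by (intro sin_gt_zero) auto
  have cos: "0 < cos (\<nu> * \<theta>)" using \<theta> by (intro cos_gt_zero) auto
  \<comment> \<open>\<open>B = b * sin \<theta>\<close> is chosen so that \<open>decay = B powr \<nu> * cos (\<nu> * \<theta>) \<ge> \<bar>z\<bar> + 1\<close>.\<close>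
  define B where "B = max 1 (((\<bar>z\<bar> + 1) / cos (\<nu> * \<theta>)) powr (1 / \<nu>))"
  have B: "1 \<le> B" by (simp add: B_def)
  interpret wright_wedge "B / sin \<theta>" \<theta> \<nu>
    by unfold_locales (use \<theta> sin B \<nu> in auto)
  have "(\<bar>z\<bar> + 1) / cos (\<nu> * \<theta>) = (((\<bar>z\<bar> + 1) / cos (\<nu> * \<theta>)) powr (1 / \<nu>)) powr \<nu>"
    using \<nu> cos by (simp add: powr_powr)
  also have "\<dots> \<le> B powr \<nu>" using \<nu> by (intro powr_mono2) (auto simp: B_def)
  finally have "\<bar>z\<bar> < decay"
    using cos sin unfolding decay_def by (simp add: field_simps)
  from laplace_wright[OF this]
  show "integrable (lborel_on {0<..}) (\<lambda>\<xi>. exp (- (z * \<xi>)) * wright (- \<nu>) (1 - \<nu>) (- \<xi>))"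
    and "(\<lambda>n. (- z) ^ n * rGamma (\<nu> * real n + 1)) sums
      integral\<^sup>L (lborel_on {0<..}) (\<lambda>\<xi>. exp (- (z * \<xi>)) * wright (- \<nu>) (1 - \<nu>) (- \<xi>))" by auto
qed

section \<open>Fractional integrals and the Mittag-Leffler function\<close>

text \<open>The one-parameter function \<open>E\<^sub>\<nu> = E\<^sub>\<nu>\<^sub>,\<^sub>1\<close>.\<close>

definition mittag_leffler :: "real \<Rightarrow> real \<Rightarrow> real"
  where "mittag_leffler \<nu> z = (\<Sum>n. z ^ n * rGamma (\<nu> * real n + 1))"

text \<open>For \<open>\<nu> < 1\<close> the convergence for all \<open>z\<close> is part of the Laplace transform formula.\<close>

lemma mittag_leffler_sums:
  assumes "0 < \<nu>" "\<nu> \<le> 1"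
  shows "(\<lambda>n. z ^ n * rGamma (\<nu> * real n + 1)) sums mittag_leffler \<nu> z"
    and "\<nu> = 1 \<Longrightarrow> mittag_leffler \<nu> z = exp z"
proof -
  have 1: "(\<lambda>n. z ^ n * rGamma (1 * real n + 1)) sums exp z"
    using exp_converges[of z] Gamma_fact[where 'a = real]
    by (simp add: rGamma_inverse_Gamma add.commute mult.commute)
  have "summable (\<lambda>n. z ^ n * rGamma (\<nu> * real n + 1))"
    using laplace_transform_wright(2)[of \<nu> "- z"] 1 assms by (cases "\<nu> = 1") (auto simp: sums_iff)
  then show "(\<lambda>n. z ^ n * rGamma (\<nu> * real n + 1)) sums mittag_leffler \<nu> z"
    unfolding mittag_leffler_def by (rule summable_sums)
  show "\<nu> = 1 \<Longrightarrow> mittag_leffler \<nu> z = exp z"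
    using 1 by (simp add: mittag_leffler_def sums_iff)
qed

lemma rGamma_pos: "0 < x \<Longrightarrow> 0 < rGamma (x :: real)"
  by (simp add: rGamma_inverse_Gamma Gamma_real_pos)

lemma isCont_mittag_leffler:
  assumes "0 < \<nu>" "\<nu> \<le> 1"
  shows "isCont (mittag_leffler \<nu>) z"
proof -
  have "isCont (\<lambda>x. \<Sum>n. rGamma (\<nu> * real n + 1) * x ^ n) z"
    using mittag_leffler_sums(1)[OF assms]
    by (intro isCont_powser_converges_everywhere) (auto simp: mult.commute sums_iff)
  then show ?thesis by (simp add: mittag_leffler_def[abs_def] mult.commute)
qed

lemma mittag_leffler_0: "mittag_leffler \<nu> 0 = 1"
proof -
  have "(\<lambda>n. 0 ^ n * rGamma (\<nu> * real n + 1)) sums rGamma (\<nu> * real 0 + 1)"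
    using powser_sums_zero[of "\<lambda>n. rGamma (\<nu> * real n + 1)"] by (simp add: mult.commute)
  then show ?thesis by (simp add: mittag_leffler_def sums_iff)
qed

lemma continuous_on_mittag_leffler_powr:
  assumes "0 < \<nu>" "\<nu> \<le> 1"
  shows "continuous_on {0..} (\<lambda>t. mittag_leffler \<nu> (c * t powr \<nu>))"
  using assms by (intro continuous_on_compose2[OF continuous_at_imp_continuous_on[of UNIV "mittag_leffler \<nu>"]]
        continuous_intros continuous_on_powr') (auto simp: isCont_mittag_leffler)

lemma has_bochner_integral_Beta:
  fixes a b r t :: real
  assumes ab: "0 < a" "0 < b" and rt: "r < t"
  shows "has_bochner_integral (lborel_on {r<..<t}) (\<lambda>s. (s - r) powr (a - 1) * (t - s) powr (b - 1))
           (Beta a b * (t - r) powr (a + b - 1))"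
proof (rule has_bochner_integral_nn_integral)
  have Beta: "0 < Beta a b" using ab by (simp add: Beta_def Gamma_real_pos)
  then show "0 \<le> Beta a b * (t - r) powr (a + b - 1)" by simp
  define c where "c = 1 / (t - r)"
  have c: "0 < c" using rt by (simp add: c_def)
  let ?I = "\<integral>\<^sup>+s. ennreal ((s - r) powr (a - 1) * (t - s) powr (b - 1)) \<partial>lborel_on {r<..<t}"
  have "ennreal (Beta a b) = (\<integral>\<^sup>+x. ennreal (x powr (a - 1) * (1 - x) powr (b - 1)) * indicator {0..1} x \<partial>lborel)"
    by (rule nn_integral_has_integral_lebesgue'[OF _ has_integral_Beta_real[OF ab], symmetric]) auto
  also have "\<dots> = \<bar>c\<bar> * (\<integral>\<^sup>+x. ennreal ((- (c * r) + c * x) powr (a - 1) * (1 - (- (c * r) + c * x)) powr (b - 1)) * indicator {0..1} (- (c * r) + c * x) \<partial>lborel)"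
    using c by (intro nn_integral_real_affine) auto
  also have "(\<integral>\<^sup>+x. ennreal ((- (c * r) + c * x) powr (a - 1) * (1 - (- (c * r) + c * x)) powr (b - 1)) * indicator {0..1} (- (c * r) + c * x) \<partial>lborel)
     = (\<integral>\<^sup>+x. ennreal (c powr (a + b - 2)) * (ennreal ((x - r) powr (a - 1) * (t - x) powr (b - 1)) * indicator {r<..<t} x) \<partial>lborel)"
  proof (intro nn_integral_cong)
    fix x :: real
    have ct: "c * t = 1 + c * r" using rt by (simp add: c_def field_simps)
    have e: "- (c * r) + c * x = c * (x - r)" "1 - (- (c * r) + c * x) = c * (t - x)"
      using ct by (simp_all add: algebra_simps)
    have "0 \<le> - (c * r) + c * x \<longleftrightarrow> r \<le> x"
      unfolding e(1) zero_le_mult_iff using c by auto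
    moreover have "0 \<le> 1 - (- (c * r) + c * x) \<longleftrightarrow> x \<le> t"
      unfolding e(2) zero_le_mult_iff using c by auto
    ultimately have i: "- (c * r) + c * x \<in> {0..1} \<longleftrightarrow> r \<le> x \<and> x \<le> t"
      by (simp only: atLeastAtMost_iff diff_ge_0_iff_ge)
    consider "r < x \<and> x < t" | "x = r" | "x = t" | "x < r \<or> t < x" by linarith
    then show "ennreal ((- (c * r) + c * x) powr (a - 1) * (1 - (- (c * r) + c * x)) powr (b - 1)) * indicator {0..1} (- (c * r) + c * x)
      = ennreal (c powr (a + b - 2)) * (ennreal ((x - r) powr (a - 1) * (t - x) powr (b - 1)) * indicator {r<..<t} x)"
    proof cases
      case 1
      then have "(c * (x - r)) powr (a - 1) * (c * (t - x)) powr (b - 1) = c powr (a + b - 2) * ((x - r) powr (a - 1) * (t - x) powr (b - 1))"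
        using c by (simp add: powr_mult powr_diff powr_add power2_eq_square divide_simps)
      with 1 i show ?thesis
        unfolding e(2) unfolding e(1) by (simp add: indicator_def ennreal_mult'[symmetric])
    next
      case 4
      then have "- (c * r) + c * x \<notin> {0..1}" "x \<notin> {r<..<t}" using i by auto
      then show ?thesis by simp
    qed (unfold e(2), unfold e(1), simp_all)
  qed
  also have "\<dots> = ennreal (c powr (a + b - 2)) * (\<integral>\<^sup>+x. ennreal ((x - r) powr (a - 1) * (t - x) powr (b - 1)) * indicator {r<..<t} x \<partial>lborel)"
    by (intro nn_integral_cmult) auto
  also have "(\<integral>\<^sup>+x. ennreal ((x - r) powr (a - 1) * (t - x) powr (b - 1)) * indicator {r<..<t} x \<partial>lborel) = ?I"
    by (subst nn_integral_restrict_space) auto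
  also have "\<bar>c\<bar> * (ennreal (c powr (a + b - 2)) * ?I) = ennreal (c powr (a + b - 1)) * ?I"
  proof -
    have "c * c powr (a + b - 2) = c powr (a + b - 1)"
      using c by (simp add: powr_mult_base)
    then show ?thesis using c by (simp add: mult.assoc[symmetric] ennreal_mult'[symmetric])
  qed
  finally have *: "ennreal (Beta a b) = ennreal (c powr (a + b - 1)) * ?I" .
  have "ennreal (Beta a b * (t - r) powr (a + b - 1)) = ennreal ((t - r) powr (a + b - 1)) * ennreal (Beta a b)"
    using Beta by (subst ennreal_mult'[symmetric]) (auto simp: mult.commute)
  also have "\<dots> = ennreal ((t - r) powr (a + b - 1) * c powr (a + b - 1)) * ?I"
    unfolding * by (simp add: mult.assoc ennreal_mult')
  also have "(t - r) powr (a + b - 1) * c powr (a + b - 1) = 1"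
    using rt c by (simp add: powr_mult[symmetric] c_def)
  finally show "?I = ennreal (Beta a b * (t - r) powr (a + b - 1))" by simp
qed (auto intro!: measurable_restrict_space1)

text \<open>The Riemann-Liouville integral of order \<open>\<nu>\<close>, for \<open>\<nu> = 1\<close> the ordinary integral.\<close>

definition frac_integral :: "real \<Rightarrow> (real \<Rightarrow> real) \<Rightarrow> real \<Rightarrow> real"
  where "frac_integral \<nu> f T = 1 / Gamma \<nu> * integral\<^sup>L (lborel_on {0<..<T}) (\<lambda>t. (T - t) powr (\<nu> - 1) * f t)"

lemma integrable_frac_kernel:
  fixes f :: "real \<Rightarrow> real"
  assumes \<nu>: "0 < \<nu>" and f: "continuous_on {0..} f"
  shows "integrable (lborel_on {0<..<T}) (\<lambda>t. (T - t) powr (\<nu> - 1) * f t)"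
proof (cases "0 < T")
  case True
  have "compact (f ` {0..T})" using f by (intro compact_continuous_image) (auto intro: continuous_on_subset)
  then have "bounded (f ` {0..T})" by (rule compact_imp_bounded)
  then obtain D where "\<forall>x\<in>f ` {0..T}. norm x \<le> D" unfolding bounded_iff by blast
  then have D: "norm (f t) \<le> D" if "0 \<le> t" "t \<le> T" for t using that by auto
  have "integrable (lborel_on {0<..<T}) (\<lambda>s. (s - 0) powr (1 - 1) * (T - s) powr (\<nu> - 1))"
    using has_bochner_integral_Beta[of 1 \<nu> 0 T] True \<nu> by (simp add: has_bochner_integral_iff)
  then have "integrable (lborel_on {0<..<T}) (\<lambda>s. (s - 0) powr (1 - 1) * (T - s) powr (\<nu> - 1) * D)"
    by (rule integrable_mult_left)
  then show ?thesis
  proof (rule Bochner_Integration.integrable_bound)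
    have "f \<in> borel_measurable (restrict_space borel {0<..<T})"
      using f by (intro borel_measurable_continuous_on_restrict) (auto intro: continuous_on_subset)
    then have [measurable]: "f \<in> borel_measurable (lborel_on {0<..<T})"
      by (simp add: measurable_cong_sets[OF sets_restrict_space_cong[of lborel borel]] cong: measurable_cong_sets)
    show "(\<lambda>t. (T - t) powr (\<nu> - 1) * f t) \<in> borel_measurable (lborel_on {0<..<T})"
      by measurable
    have "norm ((T - t) powr (\<nu> - 1) * f t) \<le> norm ((t - 0) powr (1 - 1) * (T - t) powr (\<nu> - 1) * D)" if "0 < t" "t < T" for t
      using D[of t] that by (auto simp: abs_mult intro!: mult_left_mono)
    then show "AE t in lborel_on {0<..<T}. norm ((T - t) powr (\<nu> - 1) * f t) \<le> norm ((t - 0) powr (1 - 1) * (T - t) powr (\<nu> - 1) * D)"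
      by (intro AE_lborel_on) auto
  qed
next
  case False
  then have "{0<..<T} = {}" by auto
  then show ?thesis by (simp add: integrable_restrict_space)
qed

lemma frac_integral_add:
  assumes "0 < \<nu>" "continuous_on {0..} f" "continuous_on {0..} g"
  shows "frac_integral \<nu> (\<lambda>t. f t + g t) T = frac_integral \<nu> f T + frac_integral \<nu> g T"
  using integrable_frac_kernel[OF assms(1,2)] integrable_frac_kernel[OF assms(1,3)]
  by (simp add: frac_integral_def ring_distribs)

lemma frac_integral_cmult: "frac_integral \<nu> (\<lambda>t. c * f t) T = c * frac_integral \<nu> f T"
  by (simp add: frac_integral_def mult.left_commute[of _ c])

lemma frac_integral_sum:
  assumes "0 < \<nu>" "finite I" "\<And>i. i \<in> I \<Longrightarrow> continuous_on {0..} (f i)"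
  shows "frac_integral \<nu> (\<lambda>t. \<Sum>i\<in>I. f i t) T = (\<Sum>i\<in>I. frac_integral \<nu> (f i) T)"
  using assms(2,3)
  by (induction I) (auto simp: frac_integral_add[OF assms(1)] continuous_on_sum frac_integral_cmult[of _ 0, simplified])

text \<open>Fractional integration maps each term of the series of \<open>mittag_leffler \<nu> (c * t powr \<nu>)\<close> to
  the next one, up to the factor \<open>c\<close>.\<close>

lemma has_bochner_integral_frac_power:
  assumes \<nu>: "0 < \<nu>" and T: "0 < T"
  shows "has_bochner_integral (lborel_on {0<..<T}) (\<lambda>t. (T - t) powr (\<nu> - 1) * (c * (t powr \<nu>) ^ n * rGamma (\<nu> * real n + 1)))
           (Gamma \<nu> * (c * (T powr \<nu>) ^ Suc n * rGamma (\<nu> * real (Suc n) + 1)))"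
proof -
  have pos: "0 < \<nu> * real n + 1" using \<nu> by (simp add: add_nonneg_pos)
  have pw: "(t powr \<nu>) ^ m = t powr (\<nu> * real m)" if "0 < t" for t m
    using that by (simp add: powr_power mult.commute)
  have "has_bochner_integral (lborel_on {0<..<T}) (\<lambda>s. (s - 0) powr (\<nu> * real n + 1 - 1) * (T - s) powr (\<nu> - 1) * (c * rGamma (\<nu> * real n + 1)))
     (Beta (\<nu> * real n + 1) \<nu> * (T - 0) powr (\<nu> * real n + 1 + \<nu> - 1) * (c * rGamma (\<nu> * real n + 1)))"
    using has_bochner_integral_Beta[OF pos \<nu> T] by (rule has_bochner_integral_mult_left)
  also have "?this \<longleftrightarrow> ?thesis"
  proof (rule has_bochner_integral_cong)
    define G where "G = Gamma (\<nu> * real n + 1)"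
    define R where "R = rGamma (\<nu> * real (Suc n) + 1)"
    have B: "Beta (\<nu> * real n + 1) \<nu> = G * Gamma \<nu> * R"
      by (simp add: Beta_def rGamma_inverse_Gamma divide_inverse algebra_simps G_def R_def)
    have GR: "G * rGamma (\<nu> * real n + 1) = 1"
      using Gamma_real_pos[OF pos] by (simp add: rGamma_inverse_Gamma G_def)
    have P: "(T - 0) powr (\<nu> * real n + 1 + \<nu> - 1) = (T powr \<nu>) ^ Suc n"
      unfolding pw[OF T] by (simp add: algebra_simps)
    have "Beta (\<nu> * real n + 1) \<nu> * (T - 0) powr (\<nu> * real n + 1 + \<nu> - 1) * (c * rGamma (\<nu> * real n + 1))
        = Gamma \<nu> * (c * (T powr \<nu>) ^ Suc n * R) * (G * rGamma (\<nu> * real n + 1))"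
      unfolding B P by (simp only: mult_ac)
    then show "Beta (\<nu> * real n + 1) \<nu> * (T - 0) powr (\<nu> * real n + 1 + \<nu> - 1) * (c * rGamma (\<nu> * real n + 1))
        = Gamma \<nu> * (c * (T powr \<nu>) ^ Suc n * rGamma (\<nu> * real (Suc n) + 1))"
      unfolding GR R_def by simp
  qed (auto simp: space_lborel_on pw mult_ac)
  finally show ?thesis .
qed

lemma frac_integral_mittag_leffler:
  assumes \<nu>: "0 < \<nu>" "\<nu> \<le> 1" and T: "0 < T"
  shows "mittag_leffler \<nu> (c * T powr \<nu>) = 1 + c * frac_integral \<nu> (\<lambda>t. mittag_leffler \<nu> (c * t powr \<nu>)) T"
proof -
  let ?M = "lborel_on {0<..<T}"
  note cont = continuous_on_mittag_leffler_powr[OF \<nu>, of c]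
  define f where "f n t = (T - t) powr (\<nu> - 1) * (c ^ n * (t powr \<nu>) ^ n * rGamma (\<nu> * real n + 1))" for n t
  have f: "has_bochner_integral ?M (f n) (Gamma \<nu> * (c ^ n * (T powr \<nu>) ^ Suc n * rGamma (\<nu> * real (Suc n) + 1)))" for n
    unfolding f_def by (rule has_bochner_integral_frac_power[OF \<nu>(1) T])
  define E where "E = mittag_leffler \<nu> (\<bar>c\<bar> * T powr \<nu>)"
  have le: "norm (\<Sum>i<n. f i t) \<le> (T - t) powr (\<nu> - 1) * E" if t: "0 < t" "t < T" for n t
  proof -
    have "norm (\<Sum>i<n. f i t) \<le> (\<Sum>i<n. (T - t) powr (\<nu> - 1) * ((\<bar>c\<bar> * T powr \<nu>) ^ i * rGamma (\<nu> * real i + 1)))"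
    proof (intro sum_norm_le)
      fix i
      have "norm (f i t) = (T - t) powr (\<nu> - 1) * ((\<bar>c\<bar> * t powr \<nu>) ^ i * rGamma (\<nu> * real i + 1))"
        using rGamma_pos[of "\<nu> * real i + 1"] \<nu> by (simp add: f_def abs_mult power_abs power_mult_distrib add_nonneg_pos)
      also have "\<dots> \<le> (T - t) powr (\<nu> - 1) * ((\<bar>c\<bar> * T powr \<nu>) ^ i * rGamma (\<nu> * real i + 1))"
        using rGamma_pos[of "\<nu> * real i + 1"] \<nu> t
        by (intro mult_left_mono mult_right_mono power_mono powr_mono2) (auto simp: add_nonneg_pos less_imp_le)
      finally show "norm (f i t) \<le> (T - t) powr (\<nu> - 1) * ((\<bar>c\<bar> * T powr \<nu>) ^ i * rGamma (\<nu> * real i + 1))" .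
    qed
    also have "\<dots> = (T - t) powr (\<nu> - 1) * (\<Sum>i<n. (\<bar>c\<bar> * T powr \<nu>) ^ i * rGamma (\<nu> * real i + 1))"
      by (simp add: sum_distrib_left)
    also have "(\<Sum>i<n. (\<bar>c\<bar> * T powr \<nu>) ^ i * rGamma (\<nu> * real i + 1)) \<le> E"
    proof -
      note s = mittag_leffler_sums(1)[OF \<nu>, of "\<bar>c\<bar> * T powr \<nu>"]
      have "0 \<le> (\<bar>c\<bar> * T powr \<nu>) ^ i * rGamma (\<nu> * real i + 1)" for i
        using rGamma_pos[of "\<nu> * real i + 1"] \<nu> by (simp add: add_nonneg_pos)
      then show ?thesis unfolding E_def sums_unique[OF s] using s
        by (intro sum_le_suminf) (auto simp: sums_iff)
    qed
    finally show ?thesis by (simp add: mult_left_mono)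
  qed
  have "(\<lambda>n. integral\<^sup>L ?M (f n)) sums integral\<^sup>L ?M (\<lambda>t. (T - t) powr (\<nu> - 1) * mittag_leffler \<nu> (c * t powr \<nu>))"
  proof (rule sums_integral_dominated(2))
    show "integrable ?M (f n)" for n using f by (simp add: has_bochner_integral_iff)
    show "integrable ?M (\<lambda>t. (T - t) powr (\<nu> - 1) * E)"
      using integrable_frac_kernel[OF \<nu>(1), of "\<lambda>_. E"] by simp
    show "AE t in ?M. (\<lambda>n. f n t) sums ((T - t) powr (\<nu> - 1) * mittag_leffler \<nu> (c * t powr \<nu>))"
    proof (intro AE_I2)
      fix t
      show "(\<lambda>n. f n t) sums ((T - t) powr (\<nu> - 1) * mittag_leffler \<nu> (c * t powr \<nu>))"
        using sums_mult[OF mittag_leffler_sums(1)[OF \<nu>, of "c * t powr \<nu>"], of "(T - t) powr (\<nu> - 1)"]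
        by (simp add: f_def power_mult_distrib)
    qed
    show "AE t in ?M. \<forall>n. norm (\<Sum>i<n. f i t) \<le> (T - t) powr (\<nu> - 1) * E"
      using le by (intro AE_lborel_on) auto
    show "(\<lambda>t. (T - t) powr (\<nu> - 1) * mittag_leffler \<nu> (c * t powr \<nu>)) \<in> borel_measurable ?M"
      using integrable_frac_kernel[OF \<nu>(1) cont] by (rule borel_measurable_integrable)
  qed
  then have "(\<lambda>n. c * (1 / Gamma \<nu> * integral\<^sup>L ?M (f n))) sums (c * frac_integral \<nu> (\<lambda>t. mittag_leffler \<nu> (c * t powr \<nu>)) T)"
    unfolding frac_integral_def by (intro sums_mult)
  moreover have "c * (1 / Gamma \<nu> * integral\<^sup>L ?M (f n)) = (c * T powr \<nu>) ^ Suc n * rGamma (\<nu> * real (Suc n) + 1)" for n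
    using f[of n] Gamma_real_pos[OF \<nu>(1)] by (simp add: has_bochner_integral_iff power_mult_distrib)
  ultimately have "(\<lambda>n. (c * T powr \<nu>) ^ Suc n * rGamma (\<nu> * real (Suc n) + 1)) sums (c * frac_integral \<nu> (\<lambda>t. mittag_leffler \<nu> (c * t powr \<nu>)) T)"
    by simp
  then have "(\<lambda>n. (c * T powr \<nu>) ^ n * rGamma (\<nu> * real n + 1)) sums (c * frac_integral \<nu> (\<lambda>t. mittag_leffler \<nu> (c * t powr \<nu>)) T + 1)"
    by (subst (asm) sums_Suc_iff) simp
  from sums_unique2[OF mittag_leffler_sums(1)[OF \<nu>] this] show ?thesis by simp
qed

text \<open>Iterating the equation \<open>n\<close> times bounds \<open>d\<close> by the \<open>n\<close>-th term of a convergent Mittag-Leffler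
  series.\<close>

lemma frac_integral_unique:
  fixes d :: "real \<Rightarrow> real"
  assumes \<nu>: "0 < \<nu>" "\<nu> \<le> 1" and d: "continuous_on {0..} d"
    and eq: "\<And>T. 0 < T \<Longrightarrow> d T = c * frac_integral \<nu> d T" and T: "0 < T"
  shows "d T = 0"
proof -
  have "compact (d ` {0..T})" using d by (intro compact_continuous_image) (auto intro: continuous_on_subset)
  then have "bounded (d ` {0..T})" by (rule compact_imp_bounded)
  then obtain D where "\<forall>x\<in>d ` {0..T}. norm x \<le> D" unfolding bounded_iff by blast
  then have D: "\<bar>d t\<bar> \<le> D" if "0 \<le> t" "t \<le> T" for t using that by auto
  have iter: "\<bar>d t\<bar> \<le> D * \<bar>c\<bar> ^ n * (t powr \<nu>) ^ n * rGamma (\<nu> * real n + 1)" if "0 < t" "t \<le> T" for t n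
    using that
  proof (induction n arbitrary: t)
    case (Suc n)
    let ?M = "lborel_on {0<..<t}"
    note B = has_bochner_integral_frac_power[OF \<nu>(1) Suc.prems(1), of "D * \<bar>c\<bar> ^ n" n]
    have "norm (integral\<^sup>L ?M (\<lambda>s. (t - s) powr (\<nu> - 1) * d s))
       \<le> integral\<^sup>L ?M (\<lambda>s. (t - s) powr (\<nu> - 1) * (D * \<bar>c\<bar> ^ n * (s powr \<nu>) ^ n * rGamma (\<nu> * real n + 1)))"
    proof (rule Bochner_Integration.integral_norm_bound_integral)
      show "integrable ?M (\<lambda>s. (t - s) powr (\<nu> - 1) * d s)" by (rule integrable_frac_kernel[OF \<nu>(1) d])
      show "norm ((t - s) powr (\<nu> - 1) * d s) \<le> (t - s) powr (\<nu> - 1) * (D * \<bar>c\<bar> ^ n * (s powr \<nu>) ^ n * rGamma (\<nu> * real n + 1))"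
        if "s \<in> space ?M" for s
      proof -
        have "0 < s" "s < t" using that by (auto simp: space_lborel_on)
        then have "\<bar>d s\<bar> \<le> D * \<bar>c\<bar> ^ n * (s powr \<nu>) ^ n * rGamma (\<nu> * real n + 1)"
          using Suc.prems by (intro Suc.IH) auto
        then show ?thesis unfolding norm_mult by (intro mult_mono) auto
      qed
    qed (use B in \<open>simp add: has_bochner_integral_iff\<close>)
    also have "\<dots> = Gamma \<nu> * (D * \<bar>c\<bar> ^ n * (t powr \<nu>) ^ Suc n * rGamma (\<nu> * real (Suc n) + 1))"
      using B by (simp add: has_bochner_integral_iff)
    finally have le: "\<bar>integral\<^sup>L ?M (\<lambda>s. (t - s) powr (\<nu> - 1) * d s)\<bar> \<le> \<dots>" by simp
    have "\<bar>d t\<bar> = \<bar>c\<bar> * (\<bar>integral\<^sup>L ?M (\<lambda>s. (t - s) powr (\<nu> - 1) * d s)\<bar> / Gamma \<nu>)"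
      using eq[OF Suc.prems(1)] Gamma_real_pos[OF \<nu>(1)] by (simp add: frac_integral_def abs_mult)
    also have "\<dots> \<le> \<bar>c\<bar> * (D * \<bar>c\<bar> ^ n * (t powr \<nu>) ^ Suc n * rGamma (\<nu> * real (Suc n) + 1))"
      using le Gamma_real_pos[OF \<nu>(1)] by (intro mult_left_mono) (auto simp: divide_le_eq mult.commute)
    finally show ?case by (simp add: mult_ac)
  qed (use D in simp)
  have "(\<lambda>n. D * ((\<bar>c\<bar> * T powr \<nu>) ^ n * rGamma (\<nu> * real n + 1))) \<longlonglongrightarrow> D * 0"
    using mittag_leffler_sums(1)[OF \<nu>] by (intro tendsto_mult_left summable_LIMSEQ_zero) (auto simp: sums_iff)
  moreover have "\<bar>d T\<bar> \<le> D * ((\<bar>c\<bar> * T powr \<nu>) ^ n * rGamma (\<nu> * real n + 1))" for n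
    using iter[OF T order_refl] by (simp add: power_mult_distrib mult_ac)
  ultimately have "\<bar>d T\<bar> \<le> D * 0"
    by (intro LIMSEQ_le_const) auto
  then show ?thesis by simp
qed

lemma integral_deriv:
  fixes f :: "real \<Rightarrow> real"
  assumes T: "0 < T" and cont: "continuous_on {0..} f"
    and diff: "\<And>t. 0 < t \<Longrightarrow> f differentiable (at t)"
    and int: "integrable (lborel_on {0<..<T}) (deriv f)"
  shows "integral\<^sup>L (lborel_on {0<..<T}) (deriv f) = f T - f 0"
proof -
  have "(deriv f has_integral (f T - f 0)) {0..T}"
  proof (rule fundamental_theorem_of_calculus_interior)
    show "continuous_on {0..T} f" using cont by (rule continuous_on_subset) auto
    show "(f has_vector_derivative deriv f x) (at x)" if "x \<in> {0<..<T}" for x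
      using diff[of x] that
      by (simp add: DERIV_deriv_iff_real_differentiable has_real_derivative_iff_has_vector_derivative[symmetric])
  qed (use T in auto)
  then have "(deriv f has_integral (f T - f 0)) {0<..<T}" by (simp add: has_integral_Icc_iff_Ioo)
  moreover have "set_integrable lborel {0<..<T} (deriv f)"
    using int by (simp add: set_lebesgue_integral_lborel_on)
  ultimately have "(LBINT x:{0<..<T}. deriv f x) = f T - f 0"
    using set_borel_integral_eq_integral(2) integral_unique by metis
  then show ?thesis by (simp add: set_lebesgue_integral_lborel_on)
qed

text \<open>Fractional integration of order \<open>\<nu>\<close> undoes the Caputo derivative. By Fubini's theorem the
  composed kernel is the Beta integral of \<open>(t - s) powr (- \<nu>) * (T - t) powr (\<nu> - 1)\<close> over
  \<open>s < t < T\<close>, which does not depend on \<open>s\<close> and \<open>T\<close>, so that only the integral of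
  \<open>deriv f\<close> remains.\<close>

lemma frac_integral_caputo_deriv:
  fixes f g :: "real \<Rightarrow> real"
  assumes \<nu>: "0 < \<nu>" "\<nu> \<le> 1" and f: "caputo_differentiable \<nu> f"
    and eq: "\<And>t. 0 < t \<Longrightarrow> caputo_deriv \<nu> f t = g t"
    and g: "continuous_on {0..} g" and T: "0 < T"
  shows "f T = f 0 + frac_integral \<nu> g T"
proof (cases "\<nu> = 1")
  case True
  have cong: "integral\<^sup>L (lborel_on {0<..<T}) (\<lambda>t. (T - t) powr (1 - 1) * g t) = integral\<^sup>L (lborel_on {0<..<T}) (deriv f)"
    using eq True by (intro Bochner_Integration.integral_cong) (auto simp: space_lborel_on caputo_deriv_def)
  have "integrable (lborel_on {0<..<T}) (\<lambda>t. (T - t) powr (1 - 1) * g t)"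
    using integrable_frac_kernel[of 1 g T] g by simp
  also have "?this \<longleftrightarrow> integrable (lborel_on {0<..<T}) (deriv f)"
    using eq True by (intro Bochner_Integration.integrable_cong) (auto simp: space_lborel_on caputo_deriv_def)
  finally have "integral\<^sup>L (lborel_on {0<..<T}) (deriv f) = f T - f 0"
    using f T by (intro integral_deriv) (auto simp: caputo_differentiable_def)
  then show ?thesis using cong True by (simp add: frac_integral_def)
next
  case False
  then have \<nu>1: "\<nu> < 1" using \<nu> by simp
  let ?M = "lborel_on {0<..<T}"
  interpret pair_sigma_finite ?M ?M by (intro pair_sigma_finite_lborel_on) auto
  have cd: "integrable (lborel_on {0<..<t}) (\<lambda>s. deriv f s / (t - s) powr \<nu>)" if "0 < t" for t
    using f that False by (auto simp: caputo_differentiable_def set_lebesgue_integral_lborel_on)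
  have f': "integrable ?M (deriv f)"
  proof (rule Bochner_Integration.integrable_bound)
    show "integrable ?M (\<lambda>s. T powr \<nu> * (deriv f s / (T - s) powr \<nu>))"
      using cd[OF T] by (rule integrable_mult_right)
    have [measurable]: "(\<lambda>s. deriv f s / (T - s) powr \<nu>) \<in> borel_measurable ?M"
      using cd[OF T] by (rule borel_measurable_integrable)
    have "(\<lambda>s. deriv f s / (T - s) powr \<nu> * (T - s) powr \<nu>) \<in> borel_measurable ?M" by measurable
    also have "?this \<longleftrightarrow> deriv f \<in> borel_measurable ?M"
      by (intro measurable_cong) (auto simp: space_lborel_on)
    finally show "deriv f \<in> borel_measurable ?M" .
    have "norm (deriv f s) \<le> norm (T powr \<nu> * (deriv f s / (T - s) powr \<nu>))" if "0 < s" "s < T" for s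
    proof -
      have "(T - s) powr \<nu> \<le> T powr \<nu>" using that \<nu> by (intro powr_mono2) auto
      then have "\<bar>deriv f s\<bar> * (T - s) powr \<nu> \<le> \<bar>deriv f s\<bar> * T powr \<nu>" by (intro mult_left_mono) auto
      then show ?thesis using that by (simp add: abs_mult field_simps)
    qed
    then show "AE s in ?M. norm (deriv f s) \<le> norm (T powr \<nu> * (deriv f s / (T - s) powr \<nu>))"
      by (intro AE_lborel_on) auto
  qed
  have [measurable]: "deriv f \<in> borel_measurable ?M" using f' by (rule borel_measurable_integrable)
  define k where "k s t = indicator {s<..<T} t *\<^sub>R ((t - s) powr ((1 - \<nu>) - 1) * (T - t) powr (\<nu> - 1))" for s t :: real
  have k_eq: "k s t = (if s < t \<and> t < T then (t - s) powr (- \<nu>) * (T - t) powr (\<nu> - 1) else 0)" for s t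
    by (simp add: k_def indicator_def)
  have k: "integrable ?M (k s)" "integral\<^sup>L ?M (k s) = Gamma (1 - \<nu>) * Gamma \<nu>" if "0 < s" "s < T" for s
  proof -
    note B = has_bochner_integral_Beta[of "1 - \<nu>" \<nu> s T]
    show "integrable ?M (k s)" unfolding k_def
      using B that \<nu> \<nu>1 by (subst lborel_on_subset) (auto simp: has_bochner_integral_iff)
    show "integral\<^sup>L ?M (k s) = Gamma (1 - \<nu>) * Gamma \<nu>" unfolding k_def
      using B that \<nu> \<nu>1 by (subst lborel_on_subset) (auto simp: has_bochner_integral_iff Beta_def)
  qed
  have k_nonneg: "0 \<le> k s t" for s t by (simp add: k_eq)
  define h where "h s t = k s t * deriv f s" for s t
  have "integrable (?M \<Otimes>\<^sub>M ?M) (\<lambda>p. h (fst p) (snd p))"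
  proof (rule Fubini_integrable)
    show "(\<lambda>p. h (fst p) (snd p)) \<in> borel_measurable (?M \<Otimes>\<^sub>M ?M)"
      unfolding h_def k_eq by measurable
    have "integrable ?M (\<lambda>s. Gamma (1 - \<nu>) * Gamma \<nu> * \<bar>deriv f s\<bar>)"
      using f' by (intro integrable_mult_right integrable_abs)
    also have "?this \<longleftrightarrow> integrable ?M (\<lambda>s. \<integral>t. norm (h (fst (s, t)) (snd (s, t))) \<partial>?M)"
      using k k_nonneg by (intro Bochner_Integration.integrable_cong)
        (auto simp: space_lborel_on h_def abs_mult)
    finally show "integrable ?M (\<lambda>s. \<integral>t. norm (h (fst (s, t)) (snd (s, t))) \<partial>?M)" .
    show "AE s in ?M. integrable ?M (\<lambda>t. h (fst (s, t)) (snd (s, t)))"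
      using k(1) by (intro AE_lborel_on) (auto simp: h_def)
  qed
  then have "integrable (?M \<Otimes>\<^sub>M ?M) (case_prod h)" by (simp add: case_prod_unfold)
  from Fubini_integral[OF this]
  have F: "(\<integral>t. (\<integral>s. h s t \<partial>?M) \<partial>?M) = (\<integral>s. (\<integral>t. h s t \<partial>?M) \<partial>?M)" .
  have "(\<integral>s. (\<integral>t. h s t \<partial>?M) \<partial>?M) = (\<integral>s. Gamma (1 - \<nu>) * Gamma \<nu> * deriv f s \<partial>?M)"
    using k by (intro Bochner_Integration.integral_cong) (auto simp: space_lborel_on h_def)
  also have "\<dots> = Gamma (1 - \<nu>) * Gamma \<nu> * (f T - f 0)"
    using f f' T by (simp add: integral_deriv caputo_differentiable_def)
  finally have 1: "(\<integral>s. (\<integral>t. h s t \<partial>?M) \<partial>?M) = Gamma (1 - \<nu>) * Gamma \<nu> * (f T - f 0)" .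
  have "(\<integral>s. h s t \<partial>?M) = Gamma (1 - \<nu>) * ((T - t) powr (\<nu> - 1) * g t)" if t: "0 < t" "t < T" for t
  proof -
    have "(\<integral>s. h s t \<partial>?M) = (\<integral>s. indicator {0<..<t} s *\<^sub>R ((T - t) powr (\<nu> - 1) * (deriv f s / (t - s) powr \<nu>)) \<partial>?M)"
      using t by (intro Bochner_Integration.integral_cong)
        (auto simp: space_lborel_on h_def k_eq powr_minus divide_inverse indicator_def)
    also have "\<dots> = (\<integral>s. (T - t) powr (\<nu> - 1) * (deriv f s / (t - s) powr \<nu>) \<partial>lborel_on {0<..<t})"
      using t by (subst lborel_on_subset) auto
    also have "\<dots> = (T - t) powr (\<nu> - 1) * (\<integral>s. deriv f s / (t - s) powr \<nu> \<partial>lborel_on {0<..<t})"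
      by (rule integral_mult_right_zero)
    also have "(\<integral>s. deriv f s / (t - s) powr \<nu> \<partial>lborel_on {0<..<t}) = Gamma (1 - \<nu>) * g t"
    proof -
      have "0 < Gamma (1 - \<nu>)" using \<nu>1 by (intro Gamma_real_pos) simp
      then show ?thesis
        using eq[OF t(1)] False by (simp add: caputo_deriv_def set_lebesgue_integral_lborel_on field_simps)
    qed
    finally show ?thesis by simp
  qed
  then have "(\<integral>t. (\<integral>s. h s t \<partial>?M) \<partial>?M) = (\<integral>t. Gamma (1 - \<nu>) * ((T - t) powr (\<nu> - 1) * g t) \<partial>?M)"
    by (intro Bochner_Integration.integral_cong) (auto simp: space_lborel_on)
  also have "\<dots> = Gamma (1 - \<nu>) * (\<integral>t. (T - t) powr (\<nu> - 1) * g t \<partial>?M)" by (rule integral_mult_right_zero)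
  finally have 2: "(\<integral>t. (\<integral>s. h s t \<partial>?M) \<partial>?M) = Gamma (1 - \<nu>) * (\<integral>t. (T - t) powr (\<nu> - 1) * g t \<partial>?M)" .
  have "Gamma (1 - \<nu>) * (\<integral>t. (T - t) powr (\<nu> - 1) * g t \<partial>?M) = Gamma (1 - \<nu>) * Gamma \<nu> * (f T - f 0)"
    by (simp only: 2[symmetric] F 1)
  moreover have "0 < Gamma (1 - \<nu>)" "0 < Gamma \<nu>" using \<nu> \<nu>1 by (auto intro: Gamma_real_pos)
  ultimately have "(\<integral>t. (T - t) powr (\<nu> - 1) * g t \<partial>?M) = Gamma \<nu> * (f T - f 0)" by simp
  then show ?thesis using \<open>0 < Gamma \<nu>\<close> by (simp add: frac_integral_def)
qed

section \<open>The explicit state probabilities\<close>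

text \<open>Both indices start at \<open>0\<close>: the coefficient of the exponent \<open>l + 1\<close> in the probability of
  state \<open>n + 1\<close>.\<close>

definition yule_coeff :: "nat \<Rightarrow> nat \<Rightarrow> real"
  where "yule_coeff n l = (-1) ^ l * real (n choose l)"

text \<open>With \<open>e l\<close> for the Mittag-Leffler function of rate \<open>lam * (l + 1)\<close>, the combinations on the
  right solve the Volterra system because
  \<open>yule_coeff n l * (n - l) = n * yule_coeff (n - 1) l\<close>. The system is triangular, so uniqueness
  follows by induction on \<open>n\<close> from the uniqueness for a single equation.\<close>

lemma fractional_yule_explicit:
  assumes \<nu>: "0 < \<nu>" "\<nu> \<le> 1" and p: "fractional_yule_probs \<nu> lam p" and t: "0 < t"
  shows "p (Suc n) t = (\<Sum>l\<le>n. yule_coeff n l * mittag_leffler \<nu> (- (lam * real (Suc l)) * t powr \<nu>))"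
proof -
  define e where "e l t = mittag_leffler \<nu> (- (lam * real (Suc l)) * t powr \<nu>)" for l t
  define q where "q n t = (\<Sum>l\<le>n. yule_coeff n l * e l t)" for n t
  have e: "continuous_on {0..} (e l)" for l
    unfolding e_def using \<nu> by (rule continuous_on_mittag_leffler_powr)
  have q: "continuous_on {0..} (q n)" for n
    unfolding q_def by (intro continuous_intros e)
  have e_eq: "e l T = 1 - lam * real (Suc l) * frac_integral \<nu> (e l) T" if "0 < T" for l T
    using frac_integral_mittag_leffler[OF \<nu> that, of "- (lam * real (Suc l))"] by (simp add: e_def[abs_def])
  have q_int: "frac_integral \<nu> (q n) T = (\<Sum>l\<le>n. yule_coeff n l * frac_integral \<nu> (e l) T)" for n T
    unfolding q_def using \<nu> e
    by (subst frac_integral_sum) (auto simp: frac_integral_cmult intro!: continuous_intros)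
  have coeff: "yule_coeff n l * (real n - real l) = real n * yule_coeff (n - 1) l" if "l \<le> n" for n l
  proof (cases "l = n \<or> n = 0")
    case False
    with that have "l < n" by auto
    then have "real (n - l) * real (n choose l) = real n * real ((n - 1) choose l)"
      using binomial_absorb_comp[of n l] by (metis of_nat_mult)
    then show ?thesis using that by (simp add: yule_coeff_def of_nat_diff mult_ac)
  qed (use that in \<open>auto simp: yule_coeff_def\<close>)
  have coeff_sum: "(\<Sum>l\<le>n. yule_coeff n l) = (if n = 0 then 1 else 0)" for n
  proof -
    have "(\<Sum>l\<le>n. yule_coeff n l) = (- 1 + 1) ^ n"
      unfolding yule_coeff_def binomial_ring[of "- 1" "1::real" n] by (simp add: mult.commute)
    then show ?thesis by simp
  qed
  have q_eq: "q n T = (if n = 0 then 1 else 0) - lam * real (Suc n) * frac_integral \<nu> (q n) T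
      + lam * real n * frac_integral \<nu> (q (n - 1)) T" if T: "0 < T" for n T
  proof -
    define E where "E l = frac_integral \<nu> (e l) T" for l
    have "(\<Sum>l\<le>n. real n * yule_coeff (n - 1) l * E l) = real n * (\<Sum>l\<le>n - 1. yule_coeff (n - 1) l * E l)"
    proof (cases n)
      case (Suc m)
      then show ?thesis by (simp add: sum_distrib_left mult_ac yule_coeff_def)
    qed simp
    then have 1: "(\<Sum>l\<le>n. yule_coeff n l * (real n - real l) * E l) = real n * frac_integral \<nu> (q (n - 1)) T"
      unfolding q_int E_def using coeff by simp
    have "q n T = (\<Sum>l\<le>n. yule_coeff n l * (1 - lam * real (Suc l) * E l))"
      unfolding q_def e_eq[OF T] E_def ..
    also have "\<dots> = (\<Sum>l\<le>n. yule_coeff n l - lam * real (Suc n) * (yule_coeff n l * E l)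
        + lam * (yule_coeff n l * (real n - real l) * E l))"
      by (intro sum.cong refl) (simp add: algebra_simps)
    also have "\<dots> = (\<Sum>l\<le>n. yule_coeff n l) - lam * real (Suc n) * (\<Sum>l\<le>n. yule_coeff n l * E l)
        + lam * (\<Sum>l\<le>n. yule_coeff n l * (real n - real l) * E l)"
      by (simp add: sum.distrib sum_subtractf sum_distrib_left)
    finally show ?thesis unfolding coeff_sum 1 by (simp add: q_int E_def)
  qed
  have p_cont: "continuous_on {0..} (p (Suc n))" for n
    using p by (auto simp: fractional_yule_probs_def caputo_differentiable_def)
  have p_eq: "p (Suc n) T = (if n = 0 then 1 else 0) - lam * real (Suc n) * frac_integral \<nu> (p (Suc n)) T
      + lam * real n * frac_integral \<nu> (p n) T" if T: "0 < T" for n T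
  proof -
    have c: "continuous_on {0..} (\<lambda>t. lam * real n * p n t)"
      using p_cont by (cases n) (auto intro!: continuous_intros)
    have "p (Suc n) T = p (Suc n) 0 + frac_integral \<nu> (\<lambda>t. (- lam * real (Suc n)) * p (Suc n) t + lam * real n * p n t) T"
    proof (rule frac_integral_caputo_deriv[OF \<nu> _ _ _ T])
      show "caputo_differentiable \<nu> (p (Suc n))"
        using p by (auto simp: fractional_yule_probs_def)
      show "caputo_deriv \<nu> (p (Suc n)) t = (- lam * real (Suc n)) * p (Suc n) t + lam * real n * p n t" if "0 < t" for t
        using p that unfolding fractional_yule_probs_def by (auto dest: spec[of _ "Suc n"])
    qed (intro continuous_intros c p_cont)
    also have "frac_integral \<nu> (\<lambda>t. (- lam * real (Suc n)) * p (Suc n) t + lam * real n * p n t) T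
       = (- lam * real (Suc n)) * frac_integral \<nu> (p (Suc n)) T + lam * real n * frac_integral \<nu> (p n) T"
    proof -
      have "continuous_on {0..} (\<lambda>t. (- lam * real (Suc n)) * p (Suc n) t)" by (intro continuous_intros p_cont)
      from frac_integral_add[OF \<nu>(1) this c] show ?thesis by (simp only: frac_integral_cmult)
    qed
    also have "p (Suc n) 0 = (if n = 0 then 1 else 0)"
      using p by (auto simp: fractional_yule_probs_def)
    finally show ?thesis by simp
  qed
  have step: "p (Suc n) t = q n t"
    if IH: "\<And>T. n \<noteq> 0 \<Longrightarrow> 0 < T \<Longrightarrow> p n T = q (n - 1) T" and t: "0 < t" for n t
  proof -
    have "p (Suc n) t - q n t = 0"
    proof (rule frac_integral_unique[OF \<nu> _ _ t])
      show "continuous_on {0..} (\<lambda>t. p (Suc n) t - q n t)" by (intro continuous_intros p_cont q)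
      fix T :: real assume T: "0 < T"
      have d: "frac_integral \<nu> (\<lambda>t. p (Suc n) t - q n t) T = frac_integral \<nu> (p (Suc n)) T - frac_integral \<nu> (q n) T"
        using frac_integral_add[OF \<nu>(1) p_cont, of "\<lambda>t. -1 * q n t" n T] q
        by (simp only: frac_integral_cmult) (auto intro!: continuous_intros)
      have "real n * frac_integral \<nu> (p n) T = real n * frac_integral \<nu> (q (n - 1)) T"
      proof (cases "n = 0")
        case False
        then have "integral\<^sup>L (lborel_on {0<..<T}) (\<lambda>t. (T - t) powr (\<nu> - 1) * p n t)
           = integral\<^sup>L (lborel_on {0<..<T}) (\<lambda>t. (T - t) powr (\<nu> - 1) * q (n - 1) t)"
          using IH by (intro Bochner_Integration.integral_cong) (auto simp: space_lborel_on)
        then show ?thesis by (simp add: frac_integral_def)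
      qed simp
      then show "p (Suc n) T - q n T = (- (lam * real (Suc n))) * frac_integral \<nu> (\<lambda>t. p (Suc n) t - q n t) T"
        unfolding d p_eq[OF T] q_eq[OF T] by (simp add: algebra_simps)
    qed
    then show ?thesis by simp
  qed
  have "p (Suc n) t = q n t"
    using t
  proof (induction n arbitrary: t)
    case 0
    then show ?case using step[of 0 t] by simp
  next
    case (Suc n)
    then show ?case using step[of "Suc n" t] by simp
  qed
  then show ?thesis by (simp add: q_def e_def)
qed

section \<open>Mixing Poisson probabilities over the random intensity\<close>

lemma integral_intensity:
  fixes \<omega> lam \<xi> \<tau> :: real
  assumes "0 \<le> \<tau>"
  shows "(LBINT s:{0..\<tau>}. \<omega> * lam * \<xi> * exp (lam * \<xi> * s)) = \<omega> * (exp (lam * \<xi> * \<tau>) - 1)"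
proof -
  have "(\<integral>s. (\<omega> * lam * \<xi> * exp (lam * \<xi> * s)) * indicator {0..\<tau>} s \<partial>lborel)
      = \<omega> * exp (lam * \<xi> * \<tau>) - \<omega> * exp (lam * \<xi> * 0)"
    using assms by (intro integral_FTC_Icc_real) (auto intro!: derivative_eq_intros)
  moreover have "(LBINT s:{0..\<tau>}. \<omega> * lam * \<xi> * exp (lam * \<xi> * s))
      = (\<integral>s. (\<omega> * lam * \<xi> * exp (lam * \<xi> * s)) * indicator {0..\<tau>} s \<partial>lborel)"
    by (simp only: set_lebesgue_integral_def real_scaleR_def mult.commute)
  ultimately show ?thesis by (simp add: right_diff_distrib)
qed

text \<open>With \<open>A = exp x - 1\<close> the integral is a Gamma integral with value \<open>A ^ n / (1 + A) ^ (n + 1)\<close>: a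
  Poisson distribution with exponentially distributed mean is geometric.\<close>

lemma poisson_exponential_mixture:
  fixes x :: real
  assumes x: "0 \<le> x"
  shows "has_bochner_integral (lborel_on {0<..})
     (\<lambda>\<omega>. exp (- (\<omega> * (exp x - 1))) * (\<omega> * (exp x - 1)) ^ n / fact n * exp (- \<omega>))
     (exp (- x) * (1 - exp (- x)) ^ n)"
proof -
  have "has_bochner_integral (lborel_on {0<..})
     (\<lambda>\<omega>. \<omega> powr (real n + 1 - 1) * exp (- (exp x * \<omega>)) * ((exp x - 1) ^ n / fact n))
     (Gamma (real n + 1) / exp x powr (real n + 1) * ((exp x - 1) ^ n / fact n))"
    by (intro has_bochner_integral_mult_left has_bochner_integral_Gamma) auto
  also have "?this \<longleftrightarrow> ?thesis"
  proof (rule has_bochner_integral_cong)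
    fix \<omega> assume "\<omega> \<in> space (lborel_on {0<..})"
    then have "0 < \<omega>" by (simp add: space_lborel_on)
    then have "\<omega> powr (real n + 1 - 1) = \<omega> ^ n" by (simp add: powr_realpow)
    moreover have "exp (- (exp x * \<omega>)) = exp (- (\<omega> * (exp x - 1))) * exp (- \<omega>)"
      by (simp add: exp_add[symmetric] algebra_simps)
    ultimately show "\<omega> powr (real n + 1 - 1) * exp (- (exp x * \<omega>)) * ((exp x - 1) ^ n / fact n)
      = exp (- (\<omega> * (exp x - 1))) * (\<omega> * (exp x - 1)) ^ n / fact n * exp (- \<omega>)"
      by (simp add: power_mult_distrib mult_ac)
  next
    have "Gamma (real n + 1) = fact n" by (simp add: Gamma_fact add.commute)
    moreover have "exp x powr (real n + 1) = exp x * exp x ^ n"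
      by (simp add: powr_def exp_add ring_distribs exp_of_nat_mult)
    moreover have "1 - exp (- x) = (exp x - 1) / exp x" by (simp add: exp_minus field_simps)
    ultimately show "Gamma (real n + 1) / exp x powr (real n + 1) * ((exp x - 1) ^ n / fact n)
      = exp (- x) * (1 - exp (- x)) ^ n"
      by (simp add: power_divide exp_minus field_simps)
  qed auto
  finally show ?thesis .
qed

lemma exp_binomial_expansion:
  fixes x :: real
  shows "exp (- x) * (1 - exp (- x)) ^ n = (\<Sum>l\<le>n. yule_coeff n l * exp (- (real (Suc l) * x)))"
proof -
  have "(1 - exp (- x)) ^ n = (- exp (- x) + 1) ^ n" by simp
  also have "\<dots> = (\<Sum>l\<le>n. real (n choose l) * (- exp (- x)) ^ l)"
    by (subst binomial_ring) simp
  finally show ?thesis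
    by (auto simp: sum_distrib_left yule_coeff_def power_minus[of "exp _"] exp_of_nat_mult[symmetric]
        exp_add[symmetric] algebra_simps intro!: sum.cong)
qed

lemma fractional_yule_mixture:
  assumes \<nu>: "0 < \<nu>" "\<nu> < 1" and p: "fractional_yule_probs \<nu> lam p" and t: "0 < t"
  defines "x \<equiv> \<lambda>\<xi>. lam * \<xi> * t powr \<nu>"
  shows "has_bochner_integral (lborel_on {0<..})
    (\<lambda>\<xi>. exp (- x \<xi>) * (1 - exp (- x \<xi>)) ^ n * wright (- \<nu>) (1 - \<nu>) (- \<xi>)) (p (Suc n) t)"
proof -
  have L: "has_bochner_integral (lborel_on {0<..}) (\<lambda>\<xi>. exp (- (z * \<xi>)) * wright (- \<nu>) (1 - \<nu>) (- \<xi>)) (mittag_leffler \<nu> (- z))" for z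
    using laplace_transform_wright[OF \<nu>, of z] by (simp add: has_bochner_integral_iff mittag_leffler_def sums_iff)
  have "has_bochner_integral (lborel_on {0<..})
     (\<lambda>\<xi>. \<Sum>l\<le>n. yule_coeff n l * (exp (- (lam * real (Suc l) * t powr \<nu> * \<xi>)) * wright (- \<nu>) (1 - \<nu>) (- \<xi>)))
     (\<Sum>l\<le>n. yule_coeff n l * mittag_leffler \<nu> (- (lam * real (Suc l) * t powr \<nu>)))"
    by (intro has_bochner_integral_sum has_bochner_integral_mult_right L)
  also have "(\<Sum>l\<le>n. yule_coeff n l * mittag_leffler \<nu> (- (lam * real (Suc l) * t powr \<nu>))) = p (Suc n) t"
    using fractional_yule_explicit[OF \<nu>(1) _ p t, of n] \<nu> by simp
  also have "(\<lambda>\<xi>. \<Sum>l\<le>n. yule_coeff n l * (exp (- (lam * real (Suc l) * t powr \<nu> * \<xi>)) * wright (- \<nu>) (1 - \<nu>) (- \<xi>)))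
     = (\<lambda>\<xi>. exp (- x \<xi>) * (1 - exp (- x \<xi>)) ^ n * wright (- \<nu>) (1 - \<nu>) (- \<xi>))"
    unfolding exp_binomial_expansion by (simp add: x_def sum_distrib_left sum_distrib_right mult_ac)
  finally show ?thesis .
qed

text \<open>The density of the law is cut off at \<open>0\<close>, so the total mass of a probability measure with this
  density is the integral of the positive part of the Wright function. Comparison with the integral
  \<open>1\<close> of the Wright function itself shows that the negative part vanishes.\<close>

lemma wright_nonneg_AE:
  assumes \<nu>: "0 < \<nu>" "\<nu> < 1" and M: "prob_space M" and X: "has_wright_law M \<nu> X"
  shows "AE \<xi> in lborel_on {0<..}. 0 \<le> wright (- \<nu>) (1 - \<nu>) (- \<xi>)"
proof -
  interpret prob_space M by (rule M)
  let ?P = "lborel_on {0<..}"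
  define W where "W \<xi> = wright (- \<nu>) (1 - \<nu>) (- \<xi>)" for \<xi>
  define D where "D \<xi> = ennreal (if 0 < \<xi> then W \<xi> else 0)" for \<xi>
  have D: "distributed M lborel X D"
    using X \<nu> unfolding has_wright_law_def D_def[abs_def] W_def by simp
  have W: "integrable ?P W" "integral\<^sup>L ?P W = 1"
    using laplace_transform_wright[OF \<nu>, of 0] mittag_leffler_0[of \<nu>]
    by (auto simp: W_def[abs_def] mittag_leffler_def sums_iff)
  then have W0: "integrable ?P (\<lambda>\<xi>. max 0 (W \<xi>))" by (intro integrable_max) auto
  have "(\<integral>\<^sup>+\<xi>. D \<xi> * 1 \<partial>lborel) = (\<integral>\<^sup>+x. 1 \<partial>M)"
    by (rule distributed_nn_integral[OF D]) simp
  then have "(\<integral>\<^sup>+\<xi>. D \<xi> \<partial>lborel) = 1" by (simp add: emeasure_space_1)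
  also have "(\<integral>\<^sup>+\<xi>. D \<xi> \<partial>lborel) = (\<integral>\<^sup>+\<xi>. ennreal (max 0 (W \<xi>)) * indicator {0<..} \<xi> \<partial>lborel)"
    by (intro nn_integral_cong) (auto simp: D_def indicator_def max_def ennreal_neg)
  also have "\<dots> = (\<integral>\<^sup>+\<xi>. ennreal (max 0 (W \<xi>)) \<partial>?P)"
    by (subst nn_integral_restrict_space) auto
  also have "\<dots> = ennreal (integral\<^sup>L ?P (\<lambda>\<xi>. max 0 (W \<xi>)))"
    using W0 by (intro nn_integral_eq_integral) auto
  finally have "integral\<^sup>L ?P (\<lambda>\<xi>. max 0 (W \<xi>)) = 1"
    by (simp add: ennreal_eq_1)
  then have "integral\<^sup>L ?P (\<lambda>\<xi>. max 0 (W \<xi>) - W \<xi>) = 0" using W W0 by simp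
  then have "AE \<xi> in ?P. max 0 (W \<xi>) - W \<xi> = 0"
    using W W0 by (subst (asm) integral_nonneg_eq_0_iff_AE) auto
  then show ?thesis by eventually_elim (simp add: W_def max_def split: if_splits)
qed

lemma fractional_yule_eq_expectation:
  assumes \<nu>: "0 < \<nu>" "\<nu> \<le> 1" and lam: "0 < lam" and p: "fractional_yule_probs \<nu> lam p" and t: "0 < t"
    and M: "prob_space M" and X: "has_wright_law M \<nu> X"
  shows "0 \<le> p (Suc n) t"
    and "(\<integral>\<^sup>+a. ennreal (exp (- (lam * X a * t powr \<nu>)) * (1 - exp (- (lam * X a * t powr \<nu>))) ^ n) \<partial>M) = ennreal (p (Suc n) t)"
proof -
  interpret prob_space M by (rule M)
  define \<phi> where "\<phi> \<xi> = exp (- (lam * \<xi> * t powr \<nu>)) * (1 - exp (- (lam * \<xi> * t powr \<nu>))) ^ n" for \<xi>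
  have \<phi>_nonneg: "0 \<le> \<phi> \<xi>" if "0 < \<xi>" for \<xi>
    using that lam t by (simp add: \<phi>_def)
  have "0 \<le> p (Suc n) t \<and> (\<integral>\<^sup>+a. ennreal (\<phi> (X a)) \<partial>M) = ennreal (p (Suc n) t)"
  proof (cases "\<nu> = 1")
    case True
    have "p (Suc n) t = \<phi> 1"
      unfolding \<phi>_def exp_binomial_expansion using fractional_yule_explicit[OF \<nu> p t, of n] True
      by (simp add: mittag_leffler_sums(2) mult_ac)
    moreover have "(\<integral>\<^sup>+a. ennreal (\<phi> (X a)) \<partial>M) = (\<integral>\<^sup>+a. ennreal (\<phi> 1) \<partial>M)"
      using X True by (intro nn_integral_cong_AE) (auto simp: has_wright_law_def)
    ultimately show ?thesis using \<phi>_nonneg[of 1] by (simp add: emeasure_space_1)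
  next
    case False
    then have \<nu>1: "\<nu> < 1" using \<nu> by simp
    let ?P = "lborel_on {0<..}"
    define W where "W \<xi> = wright (- \<nu>) (1 - \<nu>) (- \<xi>)" for \<xi>
    define D where "D \<xi> = ennreal (if 0 < \<xi> then W \<xi> else 0)" for \<xi>
    have D: "distributed M lborel X D"
      using X False unfolding has_wright_law_def D_def[abs_def] W_def by simp
    have I: "integrable ?P (\<lambda>\<xi>. \<phi> \<xi> * W \<xi>)" "integral\<^sup>L ?P (\<lambda>\<xi>. \<phi> \<xi> * W \<xi>) = p (Suc n) t"
      using fractional_yule_mixture[OF \<nu>(1) \<nu>1 p t, of n] by (auto simp: has_bochner_integral_iff \<phi>_def W_def)
    have "AE \<xi> in ?P. 0 < \<xi>" by (intro AE_lborel_on) auto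
    with wright_nonneg_AE[OF \<nu>(1) \<nu>1 M X] have nonneg: "AE \<xi> in ?P. 0 \<le> \<phi> \<xi> * W \<xi>"
      by eventually_elim (simp add: W_def \<phi>_nonneg)
    have "(\<integral>\<^sup>+a. ennreal (\<phi> (X a)) \<partial>M) = (\<integral>\<^sup>+\<xi>. D \<xi> * ennreal (\<phi> \<xi>) \<partial>lborel)"
      by (rule distributed_nn_integral[OF D, symmetric]) (simp add: \<phi>_def)
    also have "\<dots> = (\<integral>\<^sup>+\<xi>. ennreal (\<phi> \<xi> * W \<xi>) * indicator {0<..} \<xi> \<partial>lborel)"
      by (intro nn_integral_cong) (auto simp: D_def indicator_def ennreal_mult'' \<phi>_nonneg mult.commute[of "\<phi> _"])
    also have "\<dots> = (\<integral>\<^sup>+\<xi>. ennreal (\<phi> \<xi> * W \<xi>) \<partial>?P)"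
      by (subst nn_integral_restrict_space) auto
    also have "\<dots> = ennreal (p (Suc n) t)"
      unfolding I(2)[symmetric] by (intro nn_integral_eq_integral I(1) nonneg)
    finally show ?thesis
      using integral_nonneg_AE[OF nonneg] I(2) by simp
  qed
  then show "0 \<le> p (Suc n) t"
    and "(\<integral>\<^sup>+a. ennreal (exp (- (lam * X a * t powr \<nu>)) * (1 - exp (- (lam * X a * t powr \<nu>))) ^ n) \<partial>M) = ennreal (p (Suc n) t)"
    by (auto simp: \<phi>_def)
qed

text \<open>Independence makes the joint law a product, so \<open>\<Omega>\<close> can be integrated out for a fixed positive
  value of \<open>X\<close>, whatever the law of \<open>X\<close>. This treats the point mass for \<open>\<nu> = 1\<close> and the
  Wright density for \<open>\<nu> < 1\<close> together.\<close>

lemma nn_integral_mixing: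
  assumes M: "prob_space M" and \<Omega>: "distributed M lborel \<Omega> (exponential_density 1)"
    and indep: "prob_space.indep_var M borel \<Omega> borel X" and pos: "AE a in M. 0 < (X a :: real)"
    and c: "0 \<le> c"
  defines "m \<equiv> \<lambda>\<omega> \<xi>. \<omega> * (exp (c * \<xi>) - 1)"
  shows "(\<integral>\<^sup>+a. ennreal (exp (- m (\<Omega> a) (X a)) * m (\<Omega> a) (X a) ^ n / fact n) \<partial>M)
     = (\<integral>\<^sup>+a. ennreal (exp (- (c * X a)) * (1 - exp (- (c * X a))) ^ n) \<partial>M)"
proof -
  interpret prob_space M by (rule M)
  have rv[measurable]: "\<Omega> \<in> borel_measurable M" "X \<in> borel_measurable M"
    using indep_var_rv1[OF indep] indep_var_rv2[OF indep] by auto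
  define h where "h \<omega> \<xi> = ennreal (exp (- m \<omega> \<xi>) * m \<omega> \<xi> ^ n / fact n)" for \<omega> \<xi>
  have h_meas[measurable]: "(\<lambda>(\<omega>, \<xi>). h \<omega> \<xi>) \<in> borel_measurable (borel \<Otimes>\<^sub>M borel)"
    unfolding h_def m_def by measurable
  interpret X: prob_space "distr M borel X" by (rule prob_space_distr) simp
  interpret O: prob_space "distr M borel \<Omega>" by (rule prob_space_distr) simp
  interpret pair_sigma_finite "distr M borel \<Omega>" "distr M borel X" ..
  have inner: "(\<integral>\<^sup>+a. h (\<Omega> a) \<xi> \<partial>M) = ennreal (exp (- (c * \<xi>)) * (1 - exp (- (c * \<xi>))) ^ n)" if \<xi>: "0 < \<xi>" for \<xi>
  proof -
    have cx: "0 \<le> c * \<xi>" using c \<xi> by simp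
    have "(\<lambda>\<omega>. exp (- m \<omega> \<xi>) * m \<omega> \<xi> ^ n / fact n) \<in> borel_measurable borel"
      unfolding m_def by (intro borel_measurable_continuous_onI continuous_intros) auto
    then have h_section: "(\<lambda>\<omega>. h \<omega> \<xi>) \<in> borel_measurable lborel" unfolding h_def by simp
    have "(\<integral>\<^sup>+a. h (\<Omega> a) \<xi> \<partial>M) = (\<integral>\<^sup>+\<omega>. ennreal (exponential_density 1 \<omega>) * h \<omega> \<xi> \<partial>lborel)"
      by (rule distributed_nn_integral[OF \<Omega> h_section, symmetric])
    also have "\<dots> = (\<integral>\<^sup>+\<omega>. ennreal (exp (- (\<omega> * (exp (c * \<xi>) - 1))) * (\<omega> * (exp (c * \<xi>) - 1)) ^ n / fact n * exp (- \<omega>)) * indicator {0<..} \<omega> \<partial>lborel)"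
    proof (rule nn_integral_cong_AE)
      show "AE \<omega> in lborel. ennreal (exponential_density 1 \<omega>) * h \<omega> \<xi>
        = ennreal (exp (- (\<omega> * (exp (c * \<xi>) - 1))) * (\<omega> * (exp (c * \<xi>) - 1)) ^ n / fact n * exp (- \<omega>)) * indicator {0<..} \<omega>"
        \<comment> \<open>The exponential density is \<open>1\<close> at \<open>0\<close>, which the open half line excludes.\<close>
        using AE_lborel_singleton[of 0]
        by eventually_elim
          (auto simp: exponential_density_def h_def m_def indicator_def ennreal_mult'[symmetric] mult.commute)
    qed
    also have "\<dots> = (\<integral>\<^sup>+\<omega>. ennreal (exp (- (\<omega> * (exp (c * \<xi>) - 1))) * (\<omega> * (exp (c * \<xi>) - 1)) ^ n / fact n * exp (- \<omega>)) \<partial>lborel_on {0<..})"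
      by (subst nn_integral_restrict_space) auto
    also have "\<dots> = ennreal (exp (- (c * \<xi>)) * (1 - exp (- (c * \<xi>))) ^ n)"
    proof -
      note P = poisson_exponential_mixture[OF cx, of n, unfolded has_bochner_integral_iff]
      have "AE \<omega> in lborel_on {0<..}. 0 \<le> exp (- (\<omega> * (exp (c * \<xi>) - 1))) * (\<omega> * (exp (c * \<xi>) - 1)) ^ n / fact n * exp (- \<omega>)"
        using cx by (intro AE_lborel_on) auto
      from nn_integral_eq_integral[OF conjunct1[OF P] this] show ?thesis
        unfolding conjunct2[OF P] .
    qed
    finally show ?thesis .
  qed
  have "(\<integral>\<^sup>+a. h (\<Omega> a) (X a) \<partial>M) = (\<integral>\<^sup>+q. (\<lambda>(\<omega>, \<xi>). h \<omega> \<xi>) q \<partial>distr M (borel \<Otimes>\<^sub>M borel) (\<lambda>a. (\<Omega> a, X a)))"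
    by (subst nn_integral_distr) auto
  also have "distr M (borel \<Otimes>\<^sub>M borel) (\<lambda>a. (\<Omega> a, X a)) = distr M borel \<Omega> \<Otimes>\<^sub>M distr M borel X"
    using indep indep_var_distribution_eq[of borel \<Omega> borel X] by simp
  also have "(\<integral>\<^sup>+q. (\<lambda>(\<omega>, \<xi>). h \<omega> \<xi>) q \<partial>(distr M borel \<Omega> \<Otimes>\<^sub>M distr M borel X))
     = (\<integral>\<^sup>+\<xi>. \<integral>\<^sup>+\<omega>. h \<omega> \<xi> \<partial>distr M borel \<Omega> \<partial>distr M borel X)"
    by (subst nn_integral_snd[symmetric]) auto
  also have "\<dots> = (\<integral>\<^sup>+b. \<integral>\<^sup>+\<omega>. h \<omega> (X b) \<partial>distr M borel \<Omega> \<partial>M)"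
    by (subst nn_integral_distr) auto
  also have "\<dots> = (\<integral>\<^sup>+b. \<integral>\<^sup>+a. h (\<Omega> a) (X b) \<partial>M \<partial>M)"
    by (intro nn_integral_cong) (subst nn_integral_distr, auto)
  also have "\<dots> = (\<integral>\<^sup>+b. ennreal (exp (- (c * X b)) * (1 - exp (- (c * X b))) ^ n) \<partial>M)"
    using pos by (intro nn_integral_cong_AE) (auto elim!: eventually_mono simp: inner)
  finally show ?thesis by (simp add: h_def)
qed

section \<open>The mixed Poisson process\<close>

text \<open>The one-dimensional marginal is the increment over \<open>{0..t}\<close>, since \<open>N 0 = 0\<close> almost surely.\<close>

lemma mixed_poisson_process_marginal:
  fixes Z :: "'a \<Rightarrow> 'z" and N :: "real \<Rightarrow> 'a \<Rightarrow> nat"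
  assumes M: "prob_space M" and N: "mixed_poisson_process M S Z \<l> N" and t: "0 < t"
  shows "measure M {x \<in> space M. N t x = n} =
    (LINT x|M. exp (- (LBINT s:{0..t}. \<l> (Z x) s)) * (LBINT s:{0..t}. \<l> (Z x) s) ^ n / fact n)"
proof -
  interpret prob_space M by (rule M)
  have N_meas: "N s \<in> measurable M (count_space UNIV)" if "0 \<le> s" for s
    using N that by (simp add: mixed_poisson_process_def)
  note [measurable] = N_meas[OF less_imp_le[OF t]] N_meas[OF order_refl]
  have Z: "Z x \<in> space S" if "x \<in> space M" for x
    using N that by (auto simp: mixed_poisson_process_def dest: measurable_space)
  define \<tau> where "\<tau> i = (if i = 0 then 0 else t)" for i :: nat
  have "\<forall>B\<in>sets S. \<forall>n. \<forall>\<tau> j. 0 \<le> \<tau> 0 \<and> (\<forall>i<n. \<tau> i < \<tau> (Suc i)) \<longrightarrow>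
        measure M {x \<in> space M. Z x \<in> B \<and> (\<forall>i<n. N (\<tau> (Suc i)) x = N (\<tau> i) x + j i)} =
        (LINT x|M. indicator B (Z x) *
           (\<Prod>i<n. let m = (LBINT s:{\<tau> i..\<tau> (Suc i)}. \<l> (Z x) s) in
              exp (- m) * m ^ j i / fact (j i)))"
    using N unfolding mixed_poisson_process_def by blast
  from this[rule_format, OF sets.top[of S], where n = 1 and \<tau> = \<tau> and j = "\<lambda>_. n"]
  have incr: "measure M {x \<in> space M. Z x \<in> space S \<and> N t x = N 0 x + n} =
     (LINT x|M. indicator (space S) (Z x) *
        (exp (- (LBINT s:{0..t}. \<l> (Z x) s)) * (LBINT s:{0..t}. \<l> (Z x) s) ^ n / fact n))"
    using t by (simp add: \<tau>_def Let_def)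
  have "AE x in M. N 0 x = 0"
    using N unfolding mixed_poisson_process_def by (auto elim: eventually_mono)
  moreover have "{x \<in> space M. N t x = N 0 x + n} \<in> events"
  proof -
    have "{x \<in> space M. N t x = N 0 x + n} = (\<Union>i. {x \<in> space M. N 0 x = i} \<inter> {x \<in> space M. N t x = i + n})"
      by auto
    also have "\<dots> \<in> events" by (intro sets.countable_UN'' sets.Int) auto
    finally show ?thesis .
  qed
  ultimately have "measure M {x \<in> space M. N t x = n} = measure M {x \<in> space M. N t x = N 0 x + n}"
    by (intro measure_eq_AE) (auto elim: eventually_mono)
  also have "{x \<in> space M. N t x = N 0 x + n} = {x \<in> space M. Z x \<in> space S \<and> N t x = N 0 x + n}"
    using Z by auto
  finally have "measure M {x \<in> space M. N t x = n} = (LINT x|M. indicator (space S) (Z x) *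
        (exp (- (LBINT s:{0..t}. \<l> (Z x) s)) * (LBINT s:{0..t}. \<l> (Z x) s) ^ n / fact n))"
    unfolding incr .
  also have "\<dots> = (LINT x|M. exp (- (LBINT s:{0..t}. \<l> (Z x) s)) * (LBINT s:{0..t}. \<l> (Z x) s) ^ n / fact n)"
    using Z by (intro Bochner_Integration.integral_cong) auto
  finally show ?thesis .
qed

lemma wright_law_pos:
  assumes M: "prob_space M" and X: "has_wright_law M \<nu> X"
  shows "AE a in M. 0 < X a"
proof (cases "\<nu> = 1")
  case True
  then show ?thesis using X by (auto simp: has_wright_law_def elim: eventually_mono)
next
  case False
  interpret prob_space M by (rule M)
  from X False have "distributed M lborel X (\<lambda>\<xi>. ennreal (if 0 < \<xi> then wright (- \<nu>) (1 - \<nu>) (- \<xi>) else 0))"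
    by (simp add: has_wright_law_def)
  from distributed_AE2[OF this, of "\<lambda>\<xi>. 0 < \<xi>"] show ?thesis by (auto split: if_splits)
qed

lemma fractional_yule_eq_mixed_poisson:
  assumes \<nu>: "0 < \<nu>" "\<nu> \<le> 1" and lam: "0 < lam" and p: "fractional_yule_probs \<nu> lam p" and t: "0 < t"
    and M: "prob_space M" and \<Omega>: "distributed M lborel \<Omega> (exponential_density 1)"
    and X: "has_wright_law M \<nu> X" and indep: "prob_space.indep_var M borel \<Omega> borel X"
    and N: "mixed_poisson_process M (borel \<Otimes>\<^sub>M borel) (\<lambda>x. (\<Omega> x, X x))
         (\<lambda>(\<omega>, \<xi>) s. \<omega> * lam * \<xi> * exp (lam * \<xi> * s)) N"
  shows "p (Suc n) t = measure M {x \<in> space M. N (t powr \<nu>) x = n}"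
proof -
  interpret prob_space M by (rule M)
  let ?\<tau> = "t powr \<nu>"
  have \<tau>: "0 < ?\<tau>" using t by simp
  define m where "m a = \<Omega> a * (exp (lam * ?\<tau> * X a) - 1)" for a
  define h where "h a = exp (- m a) * m a ^ n / fact n" for a
  have [measurable]: "\<Omega> \<in> borel_measurable M" "X \<in> borel_measurable M"
    using indep_var_rv1[OF indep] indep_var_rv2[OF indep] by auto
  have meas: "h \<in> borel_measurable M" unfolding h_def[abs_def] m_def by measurable
  have "measure M {x \<in> space M. N ?\<tau> x = n} = (LINT a|M. h a)"
    using mixed_poisson_process_marginal[OF M N \<tau>, of n]
    unfolding case_prod_conv integral_intensity[OF less_imp_le[OF \<tau>]] by (simp add: h_def m_def mult_ac)
  also have "\<dots> = enn2real (\<integral>\<^sup>+a. ennreal (h a) \<partial>M)"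
  proof (rule integral_eq_nn_integral[OF meas])
    have "AE a in M. 0 \<le> \<Omega> a"
      using distributed_AE2[OF \<Omega>, of "\<lambda>\<omega>. 0 \<le> \<omega>"] by (auto simp: exponential_density_def split: if_splits)
    with wright_law_pos[OF M X] show "AE a in M. 0 \<le> h a"
    proof eventually_elim
      case (elim a)
      then have "0 \<le> m a" unfolding m_def using lam \<tau> by (intro mult_nonneg_nonneg) auto
      then show ?case by (simp add: h_def)
    qed
  qed
  also have "(\<integral>\<^sup>+a. ennreal (h a) \<partial>M)
      = (\<integral>\<^sup>+a. ennreal (exp (- (lam * ?\<tau> * X a)) * (1 - exp (- (lam * ?\<tau> * X a))) ^ n) \<partial>M)"
    unfolding h_def m_def using lam \<tau>
    by (intro nn_integral_mixing[OF M \<Omega> indep wright_law_pos[OF M X]]) simp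
  also have "\<dots> = ennreal (p (Suc n) t)"
    using fractional_yule_eq_expectation(2)[OF \<nu> lam p t M X, of n] by (simp add: mult_ac)
  also have "enn2real (ennreal (p (Suc n) t)) = p (Suc n) t"
    using fractional_yule_eq_expectation(1)[OF \<nu> lam p t M X, of n] by simp
  finally show ?thesis by simp
qed

theorem mainTheorem5:
  fixes \<nu> lam :: real and p :: "nat \<Rightarrow> real \<Rightarrow> real"
  assumes "0 < lam" and "0 < \<nu>" and "\<nu> \<le> 1"
    and "fractional_yule_probs \<nu> lam p"
  shows "\<forall>t>0. \<forall>k\<ge>1.
    (\<nu> < 1 \<longrightarrow>
      p k t =
        (LBINT \<xi>:{0<..}. LBINT \<omega>:{0<..}.
           exp (- (LBINT s:{0..t powr \<nu>}. \<omega> * lam * \<xi> * exp (lam * \<xi> * s))) *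
           (LBINT s:{0..t powr \<nu>}. \<omega> * lam * \<xi> * exp (lam * \<xi> * s)) ^ (k - 1) / fact (k - 1) *
           exp (- \<omega>) * wright (- \<nu>) (1 - \<nu>) (- \<xi>))) \<and>
    (\<nu> = 1 \<longrightarrow>
      p k t =
        (LBINT \<omega>:{0<..}.
           exp (- (LBINT s:{0..t}. \<omega> * lam * exp (lam * s))) *
           (LBINT s:{0..t}. \<omega> * lam * exp (lam * s)) ^ (k - 1) / fact (k - 1) *
           exp (- \<omega>))) \<and>
    (\<forall>(M :: 'a measure) \<Omega> \<Xi> N.
       prob_space M \<longrightarrow>
       distributed M lborel \<Omega> (exponential_density 1) \<longrightarrow>
       has_wright_law M \<nu> \<Xi> \<longrightarrow>
       prob_space.indep_var M borel \<Omega> borel \<Xi> \<longrightarrow>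
       mixed_poisson_process M (borel \<Otimes>\<^sub>M borel) (\<lambda>x. (\<Omega> x, \<Xi> x))
         (\<lambda>(\<omega>, \<xi>) s. \<omega> * lam * \<xi> * exp (lam * \<xi> * s)) N \<longrightarrow>
       p k t = measure M {x \<in> space M. N (t powr \<nu>) x = k - 1})"
proof (intro allI impI conjI)
  fix t :: real and k :: nat
  assume t: "0 < t" and "1 \<le> k"
  then obtain n where k: "k = Suc n" by (cases k) auto
  show "p k t = measure M {x \<in> space M. N (t powr \<nu>) x = k - 1}"
    if "prob_space M" "distributed M lborel \<Omega> (exponential_density 1)" "has_wright_law M \<nu> \<Xi>"
      "prob_space.indep_var M borel \<Omega> borel \<Xi>"
      "mixed_poisson_process M (borel \<Otimes>\<^sub>M borel) (\<lambda>x. (\<Omega> x, \<Xi> x))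
         (\<lambda>(\<omega>, \<xi>) s. \<omega> * lam * \<xi> * exp (lam * \<xi> * s)) N"
    for M :: "'a measure" and \<Omega> \<Xi> N
    using fractional_yule_eq_mixed_poisson[OF assms(2,3,1,4) t that, of n] by (simp add: k)
  show "p k t =
        (LBINT \<xi>:{0<..}. LBINT \<omega>:{0<..}.
           exp (- (LBINT s:{0..t powr \<nu>}. \<omega> * lam * \<xi> * exp (lam * \<xi> * s))) *
           (LBINT s:{0..t powr \<nu>}. \<omega> * lam * \<xi> * exp (lam * \<xi> * s)) ^ (k - 1) / fact (k - 1) *
           exp (- \<omega>) * wright (- \<nu>) (1 - \<nu>) (- \<xi>))" if \<nu>1: "\<nu> < 1"
  proof -
    have inner: "(LBINT \<omega>:{0<..}.
           exp (- (LBINT s:{0..t powr \<nu>}. \<omega> * lam * \<xi> * exp (lam * \<xi> * s))) *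
           (LBINT s:{0..t powr \<nu>}. \<omega> * lam * \<xi> * exp (lam * \<xi> * s)) ^ n / fact n *
           exp (- \<omega>) * wright (- \<nu>) (1 - \<nu>) (- \<xi>))
        = exp (- (lam * \<xi> * t powr \<nu>)) * (1 - exp (- (lam * \<xi> * t powr \<nu>))) ^ n * wright (- \<nu>) (1 - \<nu>) (- \<xi>)"
      if "0 < \<xi>" for \<xi>
    proof -
      have "0 \<le> lam * \<xi> * t powr \<nu>" using that assms(1) by simp
      from poisson_exponential_mixture[OF this, of n] show ?thesis
        unfolding integral_intensity[OF powr_ge_zero] set_lebesgue_integral_lborel_on(1)[OF greaterThan_borel]
        by (simp only: has_bochner_integral_iff integral_mult_left_zero)
    qed
    have "p k t = integral\<^sup>L (lborel_on {0<..})
       (\<lambda>\<xi>. exp (- (lam * \<xi> * t powr \<nu>)) * (1 - exp (- (lam * \<xi> * t powr \<nu>))) ^ n * wright (- \<nu>) (1 - \<nu>) (- \<xi>))"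
      using fractional_yule_mixture[OF assms(2) \<nu>1 assms(4) t, of n] by (simp add: k has_bochner_integral_iff)
    also have "\<dots> = integral\<^sup>L (lborel_on {0<..}) (\<lambda>\<xi>. LBINT \<omega>:{0<..}.
           exp (- (LBINT s:{0..t powr \<nu>}. \<omega> * lam * \<xi> * exp (lam * \<xi> * s))) *
           (LBINT s:{0..t powr \<nu>}. \<omega> * lam * \<xi> * exp (lam * \<xi> * s)) ^ n / fact n *
           exp (- \<omega>) * wright (- \<nu>) (1 - \<nu>) (- \<xi>))"
      using inner by (intro Bochner_Integration.integral_cong) (auto simp: space_lborel_on)
    finally show ?thesis
      unfolding set_lebesgue_integral_lborel_on(1)[OF greaterThan_borel, of 0 "\<lambda>\<xi>. LBINT \<omega>:{0<..}. G \<xi> \<omega>" for G] by (simp only: k diff_Suc_1)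
  qed
  show "p k t =
        (LBINT \<omega>:{0<..}.
           exp (- (LBINT s:{0..t}. \<omega> * lam * exp (lam * s))) *
           (LBINT s:{0..t}. \<omega> * lam * exp (lam * s)) ^ (k - 1) / fact (k - 1) *
           exp (- \<omega>))" if "\<nu> = 1"
  proof -
    have *: "(LBINT s:{0..t}. \<omega> * lam * exp (lam * s)) = \<omega> * (exp (lam * t) - 1)" for \<omega>
      using integral_intensity[OF less_imp_le[OF t], of \<omega> lam 1] by (simp only: mult_1_right)
    have "0 \<le> lam * t" using assms(1) t by simp
    from poisson_exponential_mixture[OF this, of n] have "(LBINT \<omega>:{0<..}.
           exp (- (LBINT s:{0..t}. \<omega> * lam * exp (lam * s))) *
           (LBINT s:{0..t}. \<omega> * lam * exp (lam * s)) ^ (k - 1) / fact (k - 1) *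
           exp (- \<omega>)) = exp (- (lam * t)) * (1 - exp (- (lam * t))) ^ n"
      unfolding * set_lebesgue_integral_lborel_on(1)[OF greaterThan_borel]
      by (simp only: has_bochner_integral_iff k diff_Suc_1)
    also have "\<dots> = p k t"
      unfolding exp_binomial_expansion k fractional_yule_explicit[OF assms(2-4) t]
      using that t by (simp add: mittag_leffler_sums(2) mult_ac)
    finally show ?thesis by simp
  qed
qed

end
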